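(* Let $\Lambda \subset \mathbb{R}^2$ be a uniformly discrete set with lower Beurling density $D^{-}(\Lambda) > 1$. Let $f \in L^2(\mathbb{R})$ and let $g = \sum_n \lambda_n h_n$ be a (finite, complex) linear combination of Hermite functions $h_n$, $n \in \mathbb{N}_0$. Then, $f \sim g$ if and only if $|\mathcal{G}f| = |\mathcal{G}g|$ on $\Lambda$. Therefore, the set of functions in $L^2(\mathbb{R})$ which can be recovered uniquely (up to a global phase) from their Gabor transform magnitudes sampled on $\Lambda$, i.e. $$\left\{ u \in L^2(\mathbb{R}) \,\middle|\, \forall v \in L^2(\mathbb{R}): |\mathcal{G}u| = |\mathcal{G}v| \text{ on } \Lambda \Rightarrow u \sim v \right\},$$ is dense in $L^2(\mathbb{R})$.
   Context: Functions are complex-valued. Two functions satisfy $f \sim g$ if there exists $\sigma \in \mathbb{C}$ with $|\sigma| = 1$ and $f = \sigma g$. The Gabor transform of $f \in L^2(\mathbb{R})$ is $$\mathcal{G}f(x,\omega) := 2^{1/4} \int_{\mathbb{R}} f(t)\, \mathrm{e}^{-\pi(t-x)^2 - 2\pi\mathrm{i}t\omega} \,\mathrm{d}t, \qquad (x,\omega) \in \mathbb{R}^2.$$ The Bargmann transform of $f \in L^2(\mathbb{R})$ is $$\mathcal{B}f(z) := 2^{1/4} \int_{\mathbb{R}} f(t)\, \mathrm{e}^{2\pi t z - \pi t^2 - \frac{\pi}{2}z^2} \,\mathrm{d}t, \qquad z \in \mathbb{C};$$ it is a unitary operator from $L^2(\mathbb{R})$ onto the Fock space $\mathcal{F}^2(\mathbb{C})$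 of entire functions $F$ with $\|F\|_{\mathcal{F}}^2 := \int_{\mathbb{C}} |F(z)|^2 \mathrm{e}^{-\pi|z|^2} \,\mathrm{d}z < \infty$. The monomials $e_n(z) := (\pi^n/n!)^{1/2} z^n$, $n \in \mathbb{N}_0$, form an orthonormal basis of $\mathcal{F}^2(\mathbb{C})$, and the Hermite functions are defined by $h_n := \mathcal{B}^{-1}e_n$, $n \in \mathbb{N}_0$. A (countably infinite) set $\Lambda = \{\lambda_j\}_{j=1}^\infty \subset \mathbb{R}^2 \cong \mathbb{C}$ is uniformly discrete if $\inf_{j \neq k} |\lambda_j - \lambda_k| > 0$. Its lower Beurling density is $$D^{-}(\Lambda) := \liminf_{r \to \infty} \frac{\inf_{z_0} |\Lambda \cap (rK + z_0)|}{r^2},$$ where $z_0$ ranges over $\mathbb{R}^2$, $|\cdot|$ of a set denotes cardinality and $K$ is a fixed compact set of unit measure; the definition does not depend on the choice of $K$, and one may take $K = [-1/2,1/2]^2$. *)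

theory Defs
  imports "HOL-Analysis.Analysis"
begin

text \<open>
  Elements of \<open>L\<^sup>2(\<real>)\<close> are represented by honest functions; equality in \<open>L\<^sup>2(\<real>)\<close> is equality
  almost everywhere with respect to Lebesgue measure.
\<close>

definition L2 :: "(real \<Rightarrow> complex) set" where
  "L2 = {f \<in> borel_measurable lebesgue. integrable lebesgue (\<lambda>t. (norm (f t))\<^sup>2)}"

definition L2_norm :: "(real \<Rightarrow> complex) \<Rightarrow> real" where
  "L2_norm f = sqrt (LINT t|lebesgue. (norm (f t))\<^sup>2)"

definition dense_in_L2 :: "(real \<Rightarrow> complex) set \<Rightarrow> bool" where
  "dense_in_L2 S \<longleftrightarrow>
     S \<subseteq> L2 \<and> (\<forall>w\<in>L2. \<forall>\<epsilon>>0. \<exists>u\<in>S. L2_norm (\<lambda>t. w t - u t) < \<epsilon>)"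

definition phase_equiv :: "(real \<Rightarrow> complex) \<Rightarrow> (real \<Rightarrow> complex) \<Rightarrow> bool" where
  "phase_equiv f g \<longleftrightarrow>
     (\<exists>\<sigma>::complex. norm \<sigma> = 1 \<and> (AE t in lebesgue. f t = \<sigma> * g t))"

definition gabor :: "(real \<Rightarrow> complex) \<Rightarrow> real \<times> real \<Rightarrow> complex" where
  "gabor f = (\<lambda>(x, \<omega>). of_real (2 powr (1/4)) *
     (LINT t|lebesgue. f t * exp (- of_real (pi * (t - x)\<^sup>2) - 2 * of_real pi * \<i> * of_real t * of_real \<omega>)))"

definition bargmann :: "(real \<Rightarrow> complex) \<Rightarrow> complex \<Rightarrow> complex" where
  "bargmann f z = of_real (2 powr (1/4)) *
     (LINT t|lebesgue. f t * exp (2 * of_real pi * of_real t * z - of_real (pi * t\<^sup>2) - of_real pi / 2 * z\<^sup>2))"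

definition fock_monomial :: "nat \<Rightarrow> complex \<Rightarrow> complex" where
  "fock_monomial n z = of_real (sqrt (pi ^ n / fact n)) * z ^ n"

text \<open>
  The Bargmann transform is injective on \<open>L\<^sup>2(\<real>)\<close> only modulo null sets, so the inverse image below
  is one (unspecified) representative of the \<open>n\<close>-th Hermite function.
\<close>

definition hermite_function :: "nat \<Rightarrow> real \<Rightarrow> complex" where
  "hermite_function n = inv_into L2 bargmann (fock_monomial n)"

text \<open>
  Only meaningful for sets with finitely many points in each bounded region (such as uniformly
  discrete sets), because \<^const>\<open>card\<close> of an infinite set is \<open>0\<close>.
\<close>

definition lower_beurling_density :: "(real \<times> real) set \<Rightarrow> ereal" where
  "lower_beurling_density \<Lambda> =
     Liminf at_top (\<lambda>r::real. ereal (
       real (INF z0. card (\<Lambda> \<inter> (\<lambda>k. r *\<^sub>R k + z0) ` cbox (- 1/2, - 1/2) (1/2, 1/2))) / r\<^sup>2))"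

end

theory Submission
  imports Defs "HOL-Complex_Analysis.Complex_Analysis" "HOL-Probability.Distributions"
begin

text \<open>
  Under the Bargmann transform the sampled condition becomes \<open>\<bar>F\<bar> = \<bar>P\<bar>\<close> on a reflected copy of \<open>\<Lambda>\<close>,
  where \<open>P\<close> is a polynomial and \<open>F\<close> is entire with \<open>\<bar>F z\<bar> \<le> A exp (\<pi> \<bar>z\<bar>\<^sup>2 / 2)\<close>. Since the density exceeds one,
  Jensen's inequality on a large disc, applied after subtracting a Lagrange interpolation polynomial,
  bounds \<open>\<bar>F\<bar>\<close> at the centre by a small multiple of its weighted maximum plus its values on the samples.
  With a weight of polynomial growth on a disc of radius \<open>T\<close> and of Gaussian growth of type slightly
  above \<open>\<pi> / 2\<close> outside, this yields polynomial growth of \<open>F\<close>, uniformly in \<open>T\<close>. So \<open>F\<close> is a polynomial,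
  and \<open>\<bar>F\<bar>\<^sup>2 - \<bar>P\<bar>\<^sup>2\<close> is a polynomial in \<open>z\<close> and its conjugate which vanishes on a relatively dense set,
  hence identically. Therefore \<open>F = \<sigma> P\<close> with \<open>\<bar>\<sigma>\<bar> = 1\<close>. Density follows since
  polynomials times the Gaussian, the span of the Hermite functions, are dense.
\<close>

section \<open>Jensen's inequality for approximate zeros\<close>

text \<open>The samples control only the modulus of \<open>F\<close>, and the desired polynomial
  bound cannot be assumed in order to prove it: absorbing half of a weighted supremum requires that
  supremum to be finite beforehand. The truncated weight resolves this. On a disc of radius
  \<open>R\<close>, Jensen's inequality gains about
  \<open>exp (- \<gamma> * pi * R\<^sup>2 / 2)\<close> from the samples. A weight whose logarithm
  has a Laplacian between zero and \<open>g\<close> times that of the squared modulus costs only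
  \<open>exp (g * R\<^sup>2)\<close>, once a zero-free holomorphic factor has removed its harmonic
  part. Finiteness of the supremum asks for \<open>g > pi / 2\<close>, a net gain asks for
  \<open>g < \<gamma> * pi / 2\<close>, and density above one opens exactly this window. The
  Laplacian bound does not involve \<open>T\<close>, so neither do the constants. The final
  comparison of moduli cannot use isolated zeros, since a polynomial in a variable and its conjugate
  may vanish along curves. Samples going to infinity near every direction replace that
  argument.\<close>

lemma factor_out_zeros:
  fixes h :: "complex \<Rightarrow> complex"
  assumes "finite S" "open U" "S \<subseteq> U" "h holomorphic_on U" "\<And>a. a \<in> S \<Longrightarrow> h a = 0"
  obtains k where "k holomorphic_on U" "\<And>w. w \<in> U \<Longrightarrow> h w = k w * (\<Prod>a\<in>S. w - a)"
proof -
  have "\<exists>k. k holomorphic_on U \<and> (\<forall>w\<in>U. h w = k w * (\<Prod>a\<in>S. w - a))"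
    using assms
  proof (induction S arbitrary: h rule: finite_induct)
    case empty
    then show ?case by auto
  next
    case (insert a S)
    from insert.IH[of h] insert.prems obtain k where
      k: "k holomorphic_on U" "\<forall>w\<in>U. h w = k w * (\<Prod>b\<in>S. w - b)" by auto
    have "h a = 0" "a \<in> U" using insert.prems by auto
    moreover have "(\<Prod>b\<in>S. a - b) \<noteq> 0" using insert.hyps by auto
    ultimately have ka: "k a = 0" using k(2) by auto
    \<comment> \<open>The points of \<open>S\<close> differ from \<open>a\<close>, so the zero at
      \<open>a\<close> is a zero of \<open>k\<close>; the difference quotient, completed by the
      derivative, divides it out.\<close>
    define q where "q = (\<lambda>z. if z = a then deriv k a else (k z - k a) / (z - a))"
    have "q holomorphic_on U"
      unfolding q_def using k(1) \<open>open U\<close> \<open>a \<in> U\<close> by (intro pole_lemma) (auto simp: interior_open)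
    moreover have "k w = q w * (w - a)" for w
      by (cases "w = a") (auto simp: q_def ka)
    ultimately show ?case
      using k(2) insert.hyps by (intro exI[of _ q]) (auto simp: mult.assoc)
  qed
  then show ?thesis using that by blast
qed

text \<open>On \<open>\<bar>w - z\<bar> = R\<close> the factor \<open>w - a\<close> has the same modulus as \<open>R - cnj (a - z) * (w - z) / R\<close>,
  which has value \<open>R\<close> at the centre.\<close>

lemma jensen_bound:
  fixes h :: "complex \<Rightarrow> complex"
  assumes "finite S" "open U" "cball z R \<subseteq> U" "R > 0" "S \<subseteq> cball z R"
    and "h holomorphic_on U" "\<And>a. a \<in> S \<Longrightarrow> h a = 0"
    and M: "\<And>w. norm (w - z) = R \<Longrightarrow> norm (h w) \<le> M"
  shows "norm (h z) \<le> M * (\<Prod>a\<in>S. norm (a - z) / R)"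
proof -
  obtain k where k: "k holomorphic_on U" "\<And>w. w \<in> U \<Longrightarrow> h w = k w * (\<Prod>a\<in>S. w - a)"
    using factor_out_zeros[of S U h] assms by (metis order_trans)
  define H where "H = (\<lambda>w. k w * (\<Prod>a\<in>S. of_real R - cnj (a - z) * (w - z) / of_real R))"
  have holH: "H holomorphic_on U"
    unfolding H_def using \<open>R > 0\<close> by (intro holomorphic_intros k) auto
  have mod_eq: "norm (of_real R - cnj (a - z) * (w - z) / of_real R) = norm (w - a)"
    if "norm (w - z) = R" for a w
  proof -
    have sq: "of_real R * of_real R = (w - z) * cnj (w - z)"
      using complex_norm_square[of "w - z"] that by (simp add: power2_eq_square)
    have "of_real R - cnj (a - z) * (w - z) / of_real R = (w - z) * cnj (w - a) / of_real R"
      using \<open>R > 0\<close> sq by (simp add: field_simps)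
    also have "norm \<dots> = norm (w - a)" using that \<open>R > 0\<close> by (simp add: norm_mult norm_divide del: complex_cnj_diff)
    finally show ?thesis .
  qed
  have "norm (H z) \<le> M"
  proof (rule maximum_modulus_frontier[of H "cball z R"])
    show "H holomorphic_on interior (cball z R)"
      using holH assms(3) ball_subset_cball by (intro holomorphic_on_subset[OF holH]) auto
    show "continuous_on (closure (cball z R)) H"
      using holH assms(3) by (auto intro!: holomorphic_on_imp_continuous_on holomorphic_on_subset[OF holH])
    fix w assume "w \<in> frontier (cball z R)"
    then have w: "norm (w - z) = R" using \<open>R > 0\<close> by (auto simp: dist_norm norm_minus_commute)
    then have "w \<in> U" using assms(3) by (auto simp: subset_eq dist_norm norm_minus_commute)
    then have "norm (H w) = norm (h w)"
      using mod_eq[OF w] k(2)[of w] by (simp add: H_def norm_mult prod_norm[symmetric] del: complex_cnj_diff)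
    then show "norm (H w) \<le> M" using M[OF w] by simp
  qed (use \<open>R > 0\<close> in auto)
  moreover have "norm (H z) = norm (k z) * R ^ card S"
    using \<open>R > 0\<close> by (simp add: H_def norm_mult norm_power)
  moreover have "norm (h z) = norm (k z) * R ^ card S * (\<Prod>a\<in>S. norm (a - z) / R)"
  proof -
    have "z \<in> U" using assms(3) \<open>R > 0\<close> by auto
    then show ?thesis using k(2)[of z] \<open>R > 0\<close>
      by (simp add: norm_mult prod_norm[symmetric] norm_minus_commute prod_dividef)
  qed
  ultimately show ?thesis
    using \<open>R > 0\<close> by (metis mult_right_mono prod_nonneg divide_nonneg_pos norm_ge_zero)
qed

text \<open>The interpolant of \<open>h\<close> is bounded on the whole disc by
  \<open>real N * (2 * R / \<delta>) ^ N * m\<close>. This is paid twice: in the boundary bound of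
  the difference, and when the interpolant is added back at the centre. Using \<open>N\<close>
  instead of \<open>card S\<close> makes the constant uniform in \<open>z\<close>.\<close>

lemma perturbed_jensen_bound:
  fixes h :: "complex \<Rightarrow> complex"
  assumes S: "finite S" "card S \<le> N" "S \<subseteq> cball z R" 
    and sep: "\<And>a b. a \<in> S \<Longrightarrow> b \<in> S \<Longrightarrow> a \<noteq> b \<Longrightarrow> norm (a - b) \<ge> \<delta>"
    and U: "open U" "cball z R \<subseteq> U" "h holomorphic_on U" and R: "R > 0" "0 < \<delta>" "\<delta> \<le> 2 * R"
    and M: "\<And>w. norm (w - z) = R \<Longrightarrow> norm (h w) \<le> M"
    and m: "\<And>a. a \<in> S \<Longrightarrow> norm (h a) \<le> m" "0 \<le> m"
  shows "norm (h z) \<le> M * (\<Prod>a\<in>S. norm (a - z) / R) + 2 * (real N * (2 * R / \<delta>) ^ N) * m"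
proof -
  define K where "K = real N * (2 * R / \<delta>) ^ N"
  define \<rho> where "\<rho> = (\<Prod>a\<in>S. norm (a - z) / R)"
  define L where "L = (\<lambda>w. \<Sum>a\<in>S. h a * (\<Prod>b\<in>S-{a}. (w - b) / (a - b)))"
  have K0: "K \<ge> 0" using R by (simp add: K_def)
  have q1: "2 * R / \<delta> \<ge> 1" using R by simp
  have \<rho>: "0 \<le> \<rho>" "\<rho> \<le> 1"
    unfolding \<rho>_def using R S(3) by (auto intro!: prod_nonneg prod_le_1 simp: subset_eq dist_norm norm_minus_commute)
  have Lb: "norm (L w) \<le> K * m" if w: "norm (w - z) \<le> R" for w
  proof -
    have "norm (h a * (\<Prod>b\<in>S-{a}. (w - b) / (a - b))) \<le> m * (2 * R / \<delta>) ^ N" if a: "a \<in> S" for a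
    proof -
      have "norm ((w - b) / (a - b)) \<le> 2 * R / \<delta>" if b: "b \<in> S - {a}" for b
      proof -
        have "norm (w - b) \<le> norm (w - z) + norm (z - b)"
          by (metis diff_add_cancel add_diff_eq norm_triangle_ineq)
        moreover have "norm (z - b) \<le> R" using b S(3) by (auto simp: subset_eq dist_norm)
        moreover have "norm (a - b) \<ge> \<delta>" using sep a b by auto
        ultimately show ?thesis using w R by (auto simp: norm_divide intro!: frac_le)
      qed
      then have "(\<Prod>b\<in>S-{a}. norm ((w - b) / (a - b))) \<le> (\<Prod>b\<in>S-{a}. 2 * R / \<delta>)"
        by (intro prod_mono) auto
      \<comment> \<open>Since \<open>\<delta> \<le> 2 * R\<close>, the base is at least 1 and the
        exponent may be raised to \<open>N\<close>.\<close>
      also have "\<dots> \<le> (2 * R / \<delta>) ^ N"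
        using q1 S(1,2) by (auto intro!: power_increasing le_trans[OF card_mono[of S "S-{a}"]])
      finally show ?thesis using m(1)[OF a] q1 by (auto simp: norm_mult prod_norm intro!: mult_mono m(2))
    qed
    then have "norm (L w) \<le> (\<Sum>a\<in>S. m * (2 * R / \<delta>) ^ N)"
      unfolding L_def by (intro sum_norm_le) auto
    also have "\<dots> \<le> K * m" unfolding K_def using S(2) m(2) q1
      by (auto simp: mult_ac intro!: mult_left_mono mult_right_mono)
    finally show ?thesis .
  qed
  have LS: "L a = h a" if "a \<in> S" for a
  proof -
    have "(\<Prod>b\<in>S-{c}. (a - b) / (c - b)) = (if c = a then 1 else 0)" if "c \<in> S" for c
      using that \<open>a \<in> S\<close> S(1) by (auto intro!: prod.neutral prod_zero)
    then have "L a = (\<Sum>c\<in>S. h c * (if c = a then 1 else 0))" 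
      unfolding L_def by (intro sum.cong) auto
    also have "\<dots> = h a" using S(1) that by (simp add: if_distrib cong: if_cong)
    finally show ?thesis .
  qed
  have "norm (h z - L z) \<le> (M + K * m) * (\<Prod>a\<in>S. norm (a - z) / R)"
  proof (rule jensen_bound[where h = "\<lambda>w. h w - L w", OF S(1) U(1,2) R(1) S(3)])
    show "(\<lambda>w. h w - L w) holomorphic_on U"
      unfolding L_def using U(3) by (intro holomorphic_intros) auto
    show "norm (h w - L w) \<le> M + K * m" if "norm (w - z) = R" for w
      using M[OF that] Lb[of w] that norm_triangle_ineq4[of "h w" "L w"] by linarith
  qed (use LS in auto)
  moreover have "norm (h z) \<le> norm (h z - L z) + norm (L z)"
    by (metis diff_add_cancel norm_triangle_ineq)
  moreover have "norm (L z) \<le> K * m" using Lb[of z] R by simp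
  moreover have "K * m * \<rho> \<le> K * m" using \<rho> K0 m(2) by (simp add: mult_left_le)
  ultimately show ?thesis unfolding K_def[symmetric] \<rho>_def[symmetric] by (simp add: algebra_simps)
qed

section \<open>Counting points of a dense separated set\<close>

definition square_around :: "real \<Rightarrow> complex \<Rightarrow> complex set" where
  "square_around s z = {w. \<bar>Re (w - z)\<bar> \<le> s / 2 \<and> \<bar>Im (w - z)\<bar> \<le> s / 2}"

lemma square_around_eq_cbox: "square_around s z = cbox (z - Complex (s/2) (s/2)) (z + Complex (s/2) (s/2))"
proof (rule set_eqI)
  fix w
  show "w \<in> square_around s z \<longleftrightarrow> w \<in> cbox (z - Complex (s/2) (s/2)) (z + Complex (s/2) (s/2))"
    unfolding square_around_def in_cbox_complex_iff mem_Collect_eq abs_le_iff by (auto simp: field_simps)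
qed

lemma measure_square_around: "s > 0 \<Longrightarrow> measure lborel (square_around s z) = s\<^sup>2"
  by (simp add: square_around_eq_cbox measure_lborel_cbox_eq Basis_complex_def power2_eq_square)

lemma square_around_dist: "w \<in> square_around s z \<Longrightarrow> norm (w - z) \<le> s"
  using cmod_le[of "w - z"] by (auto simp: square_around_def)

lemma area_ball: "r \<ge> 0 \<Longrightarrow> measure lborel (ball (z::complex) r) = pi * r\<^sup>2"
  by (simp add: content_ball unit_ball_vol_2)

lemma emeasure_lborel_ball_neq_top: "emeasure lborel (ball c r) \<noteq> top"
  using emeasure_lborel_ball_finite[of c r] by auto

text \<open>Packing by area: the discs of radius \<open>\<delta>/2\<close> about the points are
  disjoint and lie in a disc of radius \<open>R + \<delta>/2\<close>.\<close>

lemma separated_card_le: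
  fixes S :: "complex set"
  assumes S: "finite S" "S \<subseteq> cball z R" "R > 0" "\<delta> > 0"
    and sep: "\<And>a b. a \<in> S \<Longrightarrow> b \<in> S \<Longrightarrow> a \<noteq> b \<Longrightarrow> norm (a - b) \<ge> \<delta>"
  shows "real (card S) \<le> ((2 * R + \<delta>) / \<delta>)\<^sup>2"
proof -
  have disj: "disjoint_family_on (\<lambda>a. ball a (\<delta>/2)) S"
  proof (unfold disjoint_family_on_def, intro ballI impI)
    fix a b assume "a \<in> S" "b \<in> S" "a \<noteq> b"
    then have "\<delta>/2 + \<delta>/2 \<le> dist a b" using sep by (auto simp: dist_norm)
    then show "ball a (\<delta>/2) \<inter> ball b (\<delta>/2) = {}" by (rule disjoint_ballI)
  qed
  have "real (card S) * (pi * (\<delta>/2)\<^sup>2) = (\<Sum>a\<in>S. measure lborel (ball a (\<delta>/2)))"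
    using S by (simp add: area_ball)
  also have "\<dots> = measure lborel (\<Union>a\<in>S. ball a (\<delta>/2))"
    using S disj by (intro measure_finite_Union[symmetric]) (auto simp: emeasure_lborel_ball_neq_top)
  also have "\<dots> \<le> measure lborel (ball z (R + \<delta>/2))"
  proof (rule measure_mono_fmeasurable)
    show "(\<Union>a\<in>S. ball a (\<delta>/2)) \<subseteq> ball z (R + \<delta>/2)"
    proof
      fix x assume "x \<in> (\<Union>a\<in>S. ball a (\<delta>/2))"
      then obtain a where "a \<in> S" "dist a x < \<delta>/2" by auto
      moreover have "dist z a \<le> R" using S \<open>a \<in> S\<close> by auto
      ultimately show "x \<in> ball z (R + \<delta>/2)" using dist_triangle[of z x a] by simp
    qed
  qed (auto intro!: fmeasurableI emeasure_lborel_ball_finite sets.finite_UN simp: \<open>finite S\<close>)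
  also have "\<dots> = pi * (R + \<delta>/2)\<^sup>2" using S by (simp add: area_ball)
  finally have "real (card S) * (\<delta>/2)\<^sup>2 \<le> (R + \<delta>/2)\<^sup>2" 
    by (simp add: mult.left_commute)
  then show ?thesis using S(4) by (simp add: field_simps power2_eq_square)
qed

lemma separated_finite_cball:
  fixes L :: "complex set"
  assumes "\<And>a b. a \<in> L \<Longrightarrow> b \<in> L \<Longrightarrow> a \<noteq> b \<Longrightarrow> norm (a - b) \<ge> \<delta>" "\<delta> > 0"
  shows "finite (L \<inter> cball z R)"
proof -
  have "\<And>F. F \<subseteq> L \<inter> cball z R \<Longrightarrow> finite F \<Longrightarrow> card F \<le> nat \<lceil>((2 * max R 1 + \<delta>) / \<delta>)\<^sup>2\<rceil>"
  proof -
    fix F assume F: "F \<subseteq> L \<inter> cball z R" "finite F"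
    have "F \<subseteq> cball z (max R 1)" using F by auto
    then have "real (card F) \<le> ((2 * max R 1 + \<delta>) / \<delta>)\<^sup>2"
      using assms F by (intro separated_card_le) auto
    then show "card F \<le> nat \<lceil>((2 * max R 1 + \<delta>) / \<delta>)\<^sup>2\<rceil>" by linarith
  qed
  then show ?thesis using finite_if_finite_subsets_card_bdd by blast
qed

text \<open>Averaging the number of points in a square over all its positions inside the disc.\<close>

lemma card_cball_ge:
  fixes L :: "complex set"
  assumes sep: "\<And>a b. a \<in> L \<Longrightarrow> b \<in> L \<Longrightarrow> a \<noteq> b \<Longrightarrow> norm (a - b) \<ge> \<delta>" "\<delta> > 0"
    and s: "s > 0" and dens: "\<And>z. \<gamma> * s\<^sup>2 \<le> real (card (L \<inter> square_around s z))"
    and t: "t \<ge> s"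
  shows "\<gamma> * pi * (t - s)\<^sup>2 \<le> real (card (L \<inter> cball z t))"
proof -
  define S where "S = L \<inter> cball z t"
  define A where "A = ball z (t - s)"
  have fin: "finite S" unfolding S_def by (rule separated_finite_cball[OF sep])
  have sq: "square_around s w \<in> fmeasurable lborel" for w
    by (simp add: square_around_eq_cbox)
  have Asq: "A \<inter> square_around s w \<in> fmeasurable lborel" for w
    using sq by (intro fmeasurable_Int_fmeasurable) (auto simp: A_def square_around_eq_cbox intro!: fmeasurableI emeasure_lborel_ball_finite)
  have "pi * (t - s)\<^sup>2 * (\<gamma> * s\<^sup>2) = (LINT w|lborel. indicator A w * (\<gamma> * s\<^sup>2))"
    using t by (simp add: A_def area_ball)
  also have "\<dots> \<le> (LINT w|lborel. (\<Sum>a\<in>S. indicator (A \<inter> square_around s a) w))"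
  proof (rule integral_mono)
    show "integrable lborel (\<lambda>w. indicator A w * (\<gamma> * s\<^sup>2))"
      unfolding A_def by (intro integrable_mult_left integrable_real_indicator)
        (auto simp: emeasure_lborel_ball_neq_top simp flip: top.not_eq_extremum)
    show "integrable lborel (\<lambda>w. \<Sum>a\<in>S. indicator (A \<inter> square_around s a) w :: real)"
      using Asq by (intro Bochner_Integration.integrable_sum integrable_real_indicator)
        (auto simp: fmeasurable_def)
    fix w :: complex
    show "indicator A w * (\<gamma> * s\<^sup>2) \<le> (\<Sum>a\<in>S. indicator (A \<inter> square_around s a) w)"
    proof (cases "w \<in> A")
      case True
      \<comment> \<open>A square centred in \<open>A\<close> stays inside the disc of radius
        \<open>t\<close>, and \<open>a\<close> lies in the square about \<open>w\<close> exactly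
        when \<open>w\<close> lies in the square about \<open>a\<close>. This symmetry is the double
        count.\<close>
      have "L \<inter> square_around s w = {a \<in> S. w \<in> square_around s a}"
      proof -
        have "a \<in> cball z t" if "a \<in> square_around s w" for a
        proof -
          have "dist w a \<le> s" using square_around_dist[OF that] by (simp add: dist_norm norm_minus_commute)
          moreover have "dist z w < t - s" using True by (auto simp: A_def)
          ultimately show ?thesis using dist_triangle[of z a w] by simp
        qed
        moreover have "a \<in> square_around s w \<longleftrightarrow> w \<in> square_around s a" for a
          by (simp add: square_around_def abs_minus_commute)
        ultimately show ?thesis by (auto simp: S_def)
      qed
      then have "\<gamma> * s\<^sup>2 \<le> real (card {a \<in> S. w \<in> square_around s a})"
        using dens[of w] by simp
      also have "\<dots> = (\<Sum>a\<in>S. indicator (A \<inter> square_around s a) w)"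
        using fin True by (simp add: indicator_def sum.If_cases Int_def)
      finally show ?thesis using True by simp
    qed (auto intro!: sum_nonneg)
  qed
  also have "\<dots> = (\<Sum>a\<in>S. measure lborel (A \<inter> square_around s a))"
    using Asq by (subst Bochner_Integration.integral_sum) (auto simp: fmeasurable_def)
  also have "\<dots> \<le> (\<Sum>a\<in>S. s\<^sup>2)"
  proof (rule sum_mono)
    fix a
    have "measure lborel (A \<inter> square_around s a) \<le> measure lborel (square_around s a)"
      using sq Asq by (intro measure_mono_fmeasurable) (auto simp: fmeasurable_def)
    then show "measure lborel (A \<inter> square_around s a) \<le> s\<^sup>2" using s by (simp add: measure_square_around)
  qed
  finally have "\<gamma> * pi * (t - s)\<^sup>2 * s\<^sup>2 \<le> real (card S) * s\<^sup>2" by (simp add: mult_ac)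
  then show ?thesis using s unfolding S_def by simp
qed

text \<open>The product telescopes to the least positive integer not below \<open>x\<close>, divided
  by \<open>n\<close>. Rounding radii up this way turns a product over points into counts within
  integer radii, a discrete form of Jensen's integral of the counting function.\<close>

lemma ratio_le_prod_steps:
  fixes x :: real
  assumes "n \<ge> 1" "0 \<le> x" "x \<le> real n"
  shows "x / real n \<le> (\<Prod>j=1..<n. if x \<le> real j then real j / real (j + 1) else 1)"
  using assms
proof (induction n rule: nat_induct_at_least)
  case (Suc n)
  show ?case
  proof (cases "x \<le> real n")
    case True
    have "x / real (Suc n) = x / real n * (real n / real (n + 1))" using Suc.hyps by simp
    also have "\<dots> \<le> (\<Prod>j=1..<n. if x \<le> real j then real j / real (j + 1) else 1) * (real n / real (n + 1))"
      using Suc True by (intro mult_right_mono) auto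
    finally show ?thesis using True Suc.hyps by (simp add: mult_ac)
  next
    case False
    then have "(\<Prod>j=1..<Suc n. if x \<le> real j then real j / real (j + 1) else 1) = 1"
      by (intro prod.neutral) auto
    then show ?thesis using Suc by simp
  qed
qed auto

text \<open>Exchanging the products gives the step from \<open>j\<close> to \<open>j + 1\<close> the
  exponent \<open>m j\<close>. Each step is at most \<open>exp (- 1 / (j + 1))\<close> and
  \<open>m j\<close> is at least about \<open>\<Gamma> * j\<^sup>2\<close>, so the exponents add up
  to half of \<open>\<Gamma> * n\<^sup>2\<close>, up to a linear loss.\<close>

lemma prod_radii_le:
  fixes f :: "'a \<Rightarrow> real"
  assumes S: "finite S" "\<And>a. a \<in> S \<Longrightarrow> 0 \<le> f a" "\<And>a. a \<in> S \<Longrightarrow> f a \<le> real n" and n: "n \<ge> 1"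
    and count: "\<And>j. j < n \<Longrightarrow> \<Gamma> * (real j ^ 2 - 2 * c * real j) \<le> real (card {a \<in> S. f a \<le> real j})"
    and "\<Gamma> \<ge> 0" "c \<ge> 0"
  shows "(\<Prod>a\<in>S. f a / real n) \<le> exp (- \<Gamma> * (real n ^ 2 / 2 - (2 + 2 * c) * real n))"
proof -
  define m where "m j = card {a \<in> S. f a \<le> real j}" for j
  have "(\<Prod>a\<in>S. f a / real n) \<le> (\<Prod>a\<in>S. \<Prod>j=1..<n. if f a \<le> real j then real j / real (j + 1) else 1)"
    using S n by (intro prod_mono conjI ratio_le_prod_steps) auto
  also have "\<dots> = (\<Prod>j=1..<n. \<Prod>a\<in>S. if f a \<le> real j then real j / real (j + 1) else 1)"
    by (rule prod.swap)
  also have "\<dots> = (\<Prod>j=1..<n. (real j / real (j + 1)) ^ m j)"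
    using S(1) by (simp add: prod.If_cases m_def Int_def)
  also have "\<dots> \<le> (\<Prod>j=1..<n. exp (- \<Gamma> * (real j - 1 - 2 * c)))"
  proof (intro prod_mono conjI)
    fix j assume j: "j \<in> {1..<n}"
    have "real j / real (j + 1) = 1 + (- 1 / real (j + 1))" by (simp add: field_simps)
    also have "\<dots> \<le> exp (- 1 / real (j + 1))" by (rule exp_ge_add_one_self)
    finally have "(real j / real (j + 1)) ^ m j \<le> exp (- 1 / real (j + 1)) ^ m j"
      by (intro power_mono) auto
    also have "\<dots> = exp (- (real (m j) / real (j + 1)))"
      by (simp add: exp_of_nat_mult[symmetric])
    also have "\<dots> \<le> exp (- \<Gamma> * (real j - 1 - 2 * c))"
    proof -
      have "\<Gamma> * (real j - 1 - 2 * c) * real (j + 1) \<le> \<Gamma> * (real j ^ 2 - 2 * c * real j)"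
      proof -
        have "(real j - 1 - 2 * c) * real (j + 1) \<le> real j ^ 2 - 2 * c * real j"
          using \<open>c \<ge> 0\<close> by (simp add: algebra_simps power2_eq_square)
        then show ?thesis using \<open>\<Gamma> \<ge> 0\<close> by (simp add: mult_left_mono mult.assoc)
      qed
      also have "\<dots> \<le> real (m j)" using count[of j] j unfolding m_def by auto
      finally have "\<Gamma> * (real j - 1 - 2 * c) \<le> real (m j) / real (j + 1)"
        by (simp add: pos_le_divide_eq)
      then show ?thesis by simp
    qed
    finally show "(real j / real (j + 1)) ^ m j \<le> exp (- \<Gamma> * (real j - 1 - 2 * c))" .
  qed auto
  also have "\<dots> = exp (\<Sum>j=1..<n. - \<Gamma> * (real j - 1 - 2 * c))"
    by (rule exp_sum[symmetric]) auto
  also have "(\<Sum>j=1..<n. - \<Gamma> * (real j - 1 - 2 * c)) = - \<Gamma> * (\<Sum>j=1..<n. real j - (1 + 2 * c))"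
    by (simp add: sum_distrib_left algebra_simps)
  also have "(\<Sum>j=1..<n. real j - (1 + 2 * c)) = real n * (real n - 1) / 2 - (1 + 2 * c) * (real n - 1)"
    using n by (induction n rule: nat_induct_at_least) (auto simp: field_simps)
  also have "exp (- \<Gamma> * (real n * (real n - 1) / 2 - (1 + 2 * c) * (real n - 1))) \<le>
      exp (- \<Gamma> * (real n ^ 2 / 2 - (2 + 2 * c) * real n))"
  proof -
    have "real n ^ 2 / 2 - (2 + 2 * c) * real n \<le> real n * (real n - 1) / 2 - (1 + 2 * c) * (real n - 1)"
      using \<open>c \<ge> 0\<close> by (simp add: field_simps power2_eq_square)
    then have "\<Gamma> * (real n ^ 2 / 2 - (2 + 2 * c) * real n) \<le> \<Gamma> * (real n * (real n - 1) / 2 - (1 + 2 * c) * (real n - 1))"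
      using \<open>\<Gamma> \<ge> 0\<close> by (rule mult_left_mono)
    then show ?thesis by simp
  qed
  finally show ?thesis .
qed

text \<open>The reflection in \<open>\<omega>\<close> is the one under which the Gabor transform becomes the Bargmann transform
  up to a unimodular factor and the weight of the Fock space.\<close>

definition conj_point :: "real \<times> real \<Rightarrow> complex" where
  "conj_point p = Complex (fst p) (- snd p)"

lemma conj_point_dist: "norm (conj_point p - conj_point q) = dist p q"
  by (cases p; cases q) (simp add: conj_point_def cmod_def dist_prod_def dist_real_def power2_commute)

lemma inj_conj_point: "inj conj_point"
  by (auto simp: inj_on_def conj_point_def prod_eq_iff)

text \<open>The lower limit is used at one scale \<open>s\<close> only. The infimum over centres
  makes that count uniform, and averaging over positions later transfers it to discs.\<close>

lemma density_gt_one_squares: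
  fixes \<Lambda> :: "(real \<times> real) set"
  assumes "lower_beurling_density \<Lambda> > 1"
  obtains s \<gamma> where "s > 0" "\<gamma> > 1"
    "\<And>z. \<gamma> * s\<^sup>2 \<le> real (card (conj_point ` \<Lambda> \<inter> square_around s z))"
proof -
  define n where "n r z0 = card (\<Lambda> \<inter> (\<lambda>k. r *\<^sub>R k + z0) ` cbox (- 1/2, - 1/2) (1/2, 1/2))"
    for r :: real and z0 :: "real \<times> real"
  obtain y where y: "1 < y" "y < lower_beurling_density \<Lambda>" using dense[OF assms] by blast
  then have "y < Liminf at_top (\<lambda>r::real. ereal (real (INF z0. n r z0) / r\<^sup>2))"
    unfolding lower_beurling_density_def n_def by simp
  then have "eventually (\<lambda>r::real. y < ereal (real (INF z0. n r z0) / r\<^sup>2)) at_top"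
    by (rule less_LiminfD)
  then have "eventually (\<lambda>r::real. y < ereal (real (INF z0. n r z0) / r\<^sup>2) \<and> r > 0) at_top"
    using eventually_gt_at_top eventually_conj by blast
  then obtain s :: real where s: "y < ereal (real (INF z0. n s z0) / s\<^sup>2)" "s > 0"
    using eventually_happens by fastforce
  obtain \<gamma> where \<gamma>: "y = ereal \<gamma>" "\<gamma> > 1" using y s by (cases y) auto
  show ?thesis
  proof (rule that[OF \<open>s > 0\<close> \<open>\<gamma> > 1\<close>])
    fix z
    \<comment> \<open>The square is symmetric, so \<open>conj_point\<close> maps the square about
      the mirrored centre onto the one about \<open>z\<close>.\<close>
    define z0 where "z0 = (Re z, - Im z)"
    have "\<gamma> * s\<^sup>2 \<le> real (INF z0. n s z0)"
      using s \<gamma> by (simp add: pos_less_divide_eq less_imp_le)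
    also have "(INF z0. n s z0) \<le> n s z0" by (rule cINF_lower) auto
    also have "n s z0 = card (conj_point ` \<Lambda> \<inter> square_around s z)"
    proof -
      have "(\<lambda>k. s *\<^sub>R k + z0) ` cbox (- 1/2, - 1/2) (1/2, 1/2) = {p. conj_point p \<in> square_around s z}"
      proof (intro set_eqI iffI)
        fix p assume "p \<in> (\<lambda>k. s *\<^sub>R k + z0) ` cbox (- 1/2, - 1/2) (1/2, 1/2)"
        then obtain k where "p = s *\<^sub>R k + z0" "k \<in> cbox (- 1/2, - 1/2) (1/2, 1/2)" by blast
        then obtain a b where "p = s *\<^sub>R (a, b) + z0" "-1/2 \<le> a" "a \<le> 1/2" "-1/2 \<le> b" "b \<le> 1/2"
          by (cases k) (auto simp: cbox_Pair_eq)
        moreover have "s * \<bar>a\<bar> \<le> s * (1/2)" "s * \<bar>b\<bar> \<le> s * (1/2)"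
          using calculation s by (auto intro!: mult_left_mono)
        ultimately show "p \<in> {p. conj_point p \<in> square_around s z}"
          using s by (auto simp: z0_def conj_point_def square_around_def abs_mult)
      next
        fix p assume "p \<in> {p. conj_point p \<in> square_around s z}"
        then have p: "\<bar>fst p - fst z0\<bar> \<le> s/2" "\<bar>snd p - snd z0\<bar> \<le> s/2"
          by (auto simp: z0_def conj_point_def square_around_def abs_if split: if_splits)
        define k where "k = ((fst p - fst z0) / s, (snd p - snd z0) / s)"
        have "p = s *\<^sub>R k + z0" using s by (simp add: k_def prod_eq_iff)
        moreover have "k \<in> cbox (- 1/2, - 1/2) (1/2, 1/2)"
          using p[unfolded abs_le_iff] s by (auto simp: k_def cbox_Pair_eq field_simps)
        ultimately show "p \<in> (\<lambda>k. s *\<^sub>R k + z0) ` cbox (- 1/2, - 1/2) (1/2, 1/2)" by blast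
      qed
      then have "n s z0 = card (conj_point ` (\<Lambda> \<inter> {p. conj_point p \<in> square_around s z}))"
        unfolding n_def by (simp add: card_image inj_on_subset[OF inj_conj_point])
      also have "conj_point ` (\<Lambda> \<inter> {p. conj_point p \<in> square_around s z}) = conj_point ` \<Lambda> \<inter> square_around s z"
        by auto
      finally show ?thesis .
    qed
    finally show "\<gamma> * s\<^sup>2 \<le> real (card (conj_point ` \<Lambda> \<inter> square_around s z))" by simp
  qed
qed

section \<open>Polynomial growth from samples\<close>

text \<open>As a radial function of the plane, \<open>tangent \<tau>\<close> is \<open>r\<^sup>2\<close> plus a function which is harmonic away
  from \<open>0\<close>, chosen so that it vanishes to second order at \<open>r = \<tau>\<close>.\<close>

definition tangent :: "real \<Rightarrow> real \<Rightarrow> real" where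
  "tangent \<tau> r = r\<^sup>2 - \<tau>\<^sup>2 - 2 * \<tau>\<^sup>2 * ln (r / \<tau>)"

text \<open>Vanishing up to radius \<open>T\<close> leaves a purely polynomial weight there, while
  beyond \<open>T\<close> the growth is eventually quadratic. Value and slope match at
  \<open>T\<close>, so as a radial function it is subharmonic with Laplacian at most that of
  \<open>r\<^sup>2\<close>.\<close>

definition bump :: "real \<Rightarrow> real \<Rightarrow> real" where
  "bump T r = (if r \<le> T then 0 else tangent T r)"

lemma tangent_nonneg:
  assumes "\<tau> > 0" "r > 0"
  shows "tangent \<tau> r \<ge> 0"
proof -
  have "2 * ln (r / \<tau>) = ln ((r / \<tau>)\<^sup>2)" using assms by (simp add: ln_realpow)
  also have "\<dots> \<le> (r / \<tau>)\<^sup>2 - 1" using assms by (intro ln_le_minus_one) auto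
  finally have "\<tau>\<^sup>2 * (2 * ln (r / \<tau>)) \<le> \<tau>\<^sup>2 * ((r / \<tau>)\<^sup>2 - 1)"
    by (rule mult_left_mono) auto
  also have "\<dots> = r\<^sup>2 - \<tau>\<^sup>2" using assms by (simp add: field_simps)
  finally show ?thesis by (simp add: tangent_def)
qed

text \<open>Beyond \<open>T\<close> the two tangents differ by \<open>tangent \<tau> T\<close>,
  which is nonnegative, plus a logarithm with nonnegative coefficient. The majorant matters because
  it is quadratic plus harmonic on both sides of \<open>T\<close>.\<close>

lemma bump_le_tangent:
  assumes "0 < \<tau>" "\<tau> \<le> T" "0 < r"
  shows "bump T r \<le> tangent \<tau> r"
proof (cases "r \<le> T")
  case True
  then show ?thesis using tangent_nonneg assms by (simp add: bump_def)
next
  case False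
  have "tangent \<tau> r - tangent T r = 2 * (T\<^sup>2 - \<tau>\<^sup>2) * ln (r / T) + tangent \<tau> T"
    using assms by (simp add: tangent_def ln_div algebra_simps)
  moreover have "2 * (T\<^sup>2 - \<tau>\<^sup>2) * ln (r / T) \<ge> 0"
    using assms False by (intro mult_nonneg_nonneg ln_ge_zero) (auto simp: power_mono)
  moreover have "tangent \<tau> T \<ge> 0" using assms by (intro tangent_nonneg) auto
  ultimately show ?thesis using False by (simp add: bump_def)
qed

text \<open>\<open>E\<close> cancels the harmonic part of the tangent to \<open>bump T\<close> at \<open>z\<close>, leaving \<open>g \<bar>w - z\<bar>\<^sup>2\<close>.\<close>

lemma twisting_factor:
  fixes z :: complex
  assumes g: "g \<ge> 0" and R: "R > 0" "2 * R \<le> T"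
  obtains E U where "open U" "cball z R \<subseteq> U" "E holomorphic_on U" "E z \<noteq> 0"
    "\<And>w. norm (w - z) \<le> R \<Longrightarrow>
       norm (E w) * exp (g * bump T (norm w)) \<le> exp (g * R\<^sup>2) * (norm (E z) * exp (g * bump T (norm z)))"
proof (cases "norm z \<le> R")
  \<comment> \<open>The whole disc lies where \<open>bump T\<close> is zero. Treating it apart keeps
    the logarithm of the other case away from the origin.\<close>
  case True
  show ?thesis
  proof (rule that[of UNIV "\<lambda>_. 1"])
    fix w assume "norm (w - z) \<le> R"
    then have "norm w \<le> T" using True R norm_triangle_ineq[of "w - z" z] by simp
    then show "norm (1::complex) * exp (g * bump T (norm w))
        \<le> exp (g * R\<^sup>2) * (norm (1::complex) * exp (g * bump T (norm z)))"
      using True R g by (simp add: bump_def)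
  qed auto
next
  case False
  \<comment> \<open>With this radius \<open>tangent \<tau>\<close> touches \<open>bump T\<close> at
    \<open>norm z\<close>: both vanish there if \<open>norm z \<le> T\<close>, otherwise they are
    given by the same formula.\<close>
  define \<tau> where "\<tau> = min (norm z) T"
  have z: "norm z > R" "norm z > 0" using False R by auto
  have \<tau>: "\<tau> > 0" "\<tau> \<le> T" using z R by (auto simp: \<tau>_def)
  \<comment> \<open>On this half-plane \<open>w / z\<close> has positive real part, so
    \<open>Ln\<close> is holomorphic. In \<open>E\<close> the logarithm cancels that of the tangent,
    and the linear term turns the squared modulus of \<open>w\<close> into that of
    \<open>w - z\<close> by polarisation.\<close>
  define U where "U = {w. Re (w * cnj z) > 0}"
  define E where "E = (\<lambda>w. exp (of_real (2 * g) * (of_real (\<tau>\<^sup>2) * Ln (w / z) - cnj z * w)))"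
  have U: "open U" unfolding U_def by (intro open_Collect_less continuous_intros)
  have sub: "cball z R \<subseteq> U"
  proof
    fix w assume "w \<in> cball z R"
    then have "norm (w - z) \<le> R" by (simp add: dist_norm norm_minus_commute)
    then have "norm ((w - z) * cnj z) \<le> R * norm z" by (simp add: norm_mult mult_right_mono)
    then have "Re ((w - z) * cnj z) \<ge> - (R * norm z)"
      using abs_Re_le_cmod[of "(w - z) * cnj z"] by linarith
    moreover have "Re (w * cnj z) = Re ((w - z) * cnj z) + (norm z)\<^sup>2"
      unfolding cmod_power2 by (simp add: algebra_simps power2_eq_square)
    moreover have "R * norm z < (norm z)\<^sup>2" using z by (simp add: power2_eq_square)
    ultimately show "w \<in> U" by (simp add: U_def)
  qed
  have wz: "w / z \<notin> \<real>\<^sub>\<le>\<^sub>0" "w \<noteq> 0" if "w \<in> U" for w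
  proof -
    have "w / z = w * cnj z / of_real ((norm z)\<^sup>2)"
      using z unfolding complex_norm_square by (simp add: field_simps)
    then have "Re (w / z) > 0" using that z by (simp add: U_def Re_divide_of_real)
    then show "w / z \<notin> \<real>\<^sub>\<le>\<^sub>0" "w \<noteq> 0" by (auto simp: complex_nonpos_Reals_iff)
  qed
  have nE: "norm (E w) = exp (2 * g * (\<tau>\<^sup>2 * ln (norm w / norm z) - Re (cnj z * w)))" if "w \<in> U" for w
    using wz[OF that] z by (simp add: E_def norm_divide)
  show ?thesis
  proof (rule that[OF U sub])
    show "E holomorphic_on U" unfolding E_def using wz z by (intro holomorphic_intros) auto
    show "E z \<noteq> 0" by (simp add: E_def)
    fix w assume w: "norm (w - z) \<le> R"
    then have wU: "w \<in> U" using sub by (auto simp: subset_eq dist_norm norm_minus_commute)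
    have zU: "z \<in> U" using sub R by auto
    have w0: "norm w > 0" using wz[OF wU] by simp
    have key: "2 * \<tau>\<^sup>2 * ln (norm w / norm z) + bump T (norm w) \<le> (norm w)\<^sup>2 - (norm z)\<^sup>2 + bump T (norm z)"
    proof -
      have b: "bump T (norm z) = tangent \<tau> (norm z)" 
        using z \<tau> by (auto simp: bump_def \<tau>_def tangent_def min_def)
      have "bump T (norm w) \<le> tangent \<tau> (norm w)" using \<tau> w0 by (intro bump_le_tangent)
      then show ?thesis unfolding b using z w0 \<tau> by (simp add: tangent_def ln_div algebra_simps)
    qed
    have re: "2 * Re (cnj z * w) = (norm w)\<^sup>2 + (norm z)\<^sup>2 - (norm (w - z))\<^sup>2"
      unfolding cmod_power2 by (simp add: algebra_simps power2_eq_square)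
    have "(norm (w - z))\<^sup>2 \<le> R\<^sup>2" using w by (intro power_mono) auto
    then have "2 * (\<tau>\<^sup>2 * ln (norm w / norm z) - Re (cnj z * w)) + bump T (norm w)
      \<le> R\<^sup>2 + (- 2 * (norm z)\<^sup>2 + bump T (norm z))"
      using key re unfolding right_diff_distrib mult.assoc by linarith
    from mult_left_mono[OF this g] have "2 * g * (\<tau>\<^sup>2 * ln (norm w / norm z) - Re (cnj z * w)) + g * bump T (norm w)
      \<le> g * R\<^sup>2 + (2 * g * (- (norm z)\<^sup>2) + g * bump T (norm z))"
      by (simp add: algebra_simps)
    moreover have "Re (cnj z * z) = (norm z)\<^sup>2" unfolding cmod_power2 by (simp add: power2_eq_square)
    ultimately show "norm (E w) * exp (g * bump T (norm w)) \<le> exp (g * R\<^sup>2) * (norm (E z) * exp (g * bump T (norm z)))"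
      unfolding nE[OF wU] nE[OF zU] using z by (simp flip: exp_add)
  qed
qed

text \<open>Since \<open>ln (r / T) \<le> r / T\<close>, the logarithm costs a term linear in
  \<open>r\<close>, which the surplus \<open>(g - p) * r\<^sup>2\<close> absorbs by completing the
  square. The constant depends on \<open>T\<close>, but it only serves to make a supremum
  finite.\<close>

lemma bump_dominates_quadratic:
  assumes T: "T > 0" and g: "g > p" "p \<ge> 0"
  shows "\<exists>C. \<forall>r\<ge>0. p * r\<^sup>2 \<le> g * bump T r + C"
proof -
  define a b where "a = g - p" and "b = 2 * g * T"
  have a: "a > 0" using g by (simp add: a_def)
  have "p * r\<^sup>2 \<le> g * bump T r + (g * T\<^sup>2 + b\<^sup>2 / (4 * a))" if r: "r \<ge> 0" for r
  proof (cases "r \<le> T")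
    case True
    then have "p * r\<^sup>2 \<le> g * T\<^sup>2" using g r by (intro mult_mono power_mono) auto
    then show ?thesis using True a by (simp add: bump_def add_increasing2)
  next
    case False
    then have "ln (r / T) \<le> r / T" using T by (intro ln_bound) auto
    then have "2 * T\<^sup>2 * ln (r / T) \<le> 2 * T\<^sup>2 * (r / T)" by (intro mult_left_mono) auto
    also have "\<dots> = 2 * T * r" using T by (simp add: power2_eq_square)
    finally have "bump T r \<ge> r\<^sup>2 - T\<^sup>2 - 2 * T * r" using False by (simp add: bump_def tangent_def)
    then have "g * bump T r \<ge> g * (r\<^sup>2 - T\<^sup>2 - 2 * T * r)" using g by (intro mult_left_mono) auto
    moreover have "a * r\<^sup>2 - b * r + b\<^sup>2 / (4 * a) = a * (r - b / (2 * a))\<^sup>2"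
      using a by (simp add: power2_eq_square field_simps)
    moreover have "a * (r - b / (2 * a))\<^sup>2 \<ge> 0" using a by simp
    ultimately show ?thesis by (simp add: a_def b_def algebra_simps)
  qed
  then show ?thesis by blast
qed

lemma exponential_beats:
  fixes a b :: real
  assumes "a > 0"
  obtains n :: nat where "n \<ge> 1" "real n \<ge> m" "exp (b * real n - a * real n ^ 2) \<le> 1 / 2"
proof -
  define n where "n = nat \<lceil>max (max m 1) ((b + 1) / a)\<rceil>"
  have n: "real n \<ge> m" "real n \<ge> 1" "real n \<ge> (b + 1) / a"
    unfolding n_def by linarith+
  then have "a * real n \<ge> b + 1" using assms by (simp add: field_simps)
  then have "real n * (b - a * real n) \<le> real n * (- 1)" using n by (intro mult_left_mono) auto
  then have "b * real n - a * real n ^ 2 \<le> - 1" using n by (simp add: algebra_simps power2_eq_square)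
  then have "exp (b * real n - a * real n ^ 2) \<le> exp (- 1)" by simp
  also have "exp (- 1) \<le> (1/2 :: real)"
    using exp_ge_add_one_self[of 1] by (simp add: exp_minus field_simps)
  finally show ?thesis using that n by simp
qed

text \<open>The proof is a sampling inequality with a weight \<open>W\<close> which is \<open>(1 + \<bar>z\<bar>)\<^sup>d\<close> on a disc of radius \<open>T\<close> and
  outgrows \<open>F\<close> at infinity; its constant does not depend on \<open>T\<close>, so \<open>T \<rightarrow> \<infinity>\<close> gives polynomial growth.\<close>

proposition polynomial_growth_from_samples:
  fixes F :: "complex \<Rightarrow> complex"
  assumes holF: "F holomorphic_on UNIV" and growth: "\<And>z. norm (F z) \<le> A * exp (pi / 2 * (norm z)\<^sup>2)"
    and sep: "\<And>a b. a \<in> L \<Longrightarrow> b \<in> L \<Longrightarrow> a \<noteq> b \<Longrightarrow> norm (a - b) \<ge> \<delta>" "\<delta> > 0"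
    and s: "s > 0" and \<gamma>: "\<gamma> > 1" and dens: "\<And>z. \<gamma> * s\<^sup>2 \<le> real (card (L \<inter> square_around s z))"
    and samples: "\<And>a. a \<in> L \<Longrightarrow> norm (F a) \<le> B * (1 + norm a) ^ d"
  shows "\<exists>C. \<forall>z. norm (F z) \<le> C * (1 + norm z) ^ d"
proof -
  \<comment> \<open>The midpoint of \<open>pi / 2\<close> and
    \<open>\<gamma> * pi / 2\<close>.\<close>
  define g where "g = pi * (1 + \<gamma>) / 4"
  have g: "g > pi / 2" "g > 0" "\<gamma> * pi / 2 - g > 0" using \<gamma> pi_gt_zero
    by (auto simp: g_def field_simps intro: add_pos_pos)
  have "norm (F 0) \<le> A" using growth[of 0] by simp
  then have A: "A \<ge> 0" using norm_ge_zero order_trans by blast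
  define B' where "B' = max B 0"
  have B': "B' \<ge> 0" "\<And>a. a \<in> L \<Longrightarrow> norm (F a) \<le> B' * (1 + norm a) ^ d"
    using samples by (auto simp: B'_def intro!: order_trans[OF samples] mult_right_mono)
  \<comment> \<open>The radius at which Jensen's gain beats the variation of the weight, leaving a
    factor of at most one half; it is chosen before \<open>T\<close>.\<close>
  obtain n :: nat where n: "n \<ge> 1" "real n \<ge> \<delta>" and
    small: "exp ((real d + \<gamma> * pi * (2 + 2 * s)) * real n - (\<gamma> * pi / 2 - g) * real n ^ 2) \<le> 1 / 2"
    using exponential_beats[OF g(3)] by metis
  define R where "R = real n"
  have R: "R > 0" "\<delta> \<le> 2 * R" using n sep by (auto simp: R_def)
  \<comment> \<open>The largest growth of the twisted weight from the centre over a disc of radius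
    \<open>R\<close>: \<open>exp (g * R\<^sup>2)\<close> from the truncated Gaussian part,
    \<open>(1 + R) ^ d\<close> from the polynomial part.\<close>
  define \<kappa> where "\<kappa> = exp (g * R\<^sup>2) * (1 + R) ^ d"
  define N where "N = nat \<lceil>((2 * R + \<delta>) / \<delta>)\<^sup>2\<rceil>"
  define K where "K = 2 * (real N * (2 * R / \<delta>) ^ N)"
  have pos: "\<kappa> > 0" "K \<ge> 0" using R sep by (auto simp: \<kappa>_def K_def)
  have \<rho>: "\<kappa> * (\<Prod>a\<in>L \<inter> cball z R. norm (a - z) / R) \<le> 1 / 2" for z
  proof -
    have "(\<Prod>a\<in>L \<inter> cball z R. norm (a - z) / R) \<le> exp (- (\<gamma> * pi) * (R ^ 2 / 2 - (2 + 2 * s) * R))"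
      unfolding R_def
    proof (rule prod_radii_le)
      show "finite (L \<inter> cball z (real n))" by (rule separated_finite_cball[OF sep])
      fix j assume j: "j < n"
      have eq: "{a \<in> L \<inter> cball z (real n). norm (a - z) \<le> real j} = L \<inter> cball z (real j)"
        using j by (auto simp: dist_norm norm_minus_commute)
      show "\<gamma> * pi * ((real j)\<^sup>2 - 2 * s * real j) \<le> real (card {a \<in> L \<inter> cball z (real n). norm (a - z) \<le> real j})"
      proof (cases "real j \<ge> s")
        case True
        have "\<gamma> * pi * ((real j)\<^sup>2 - 2 * s * real j) \<le> \<gamma> * pi * (real j - s)\<^sup>2"
          using \<gamma> by (intro mult_left_mono) (auto simp: power2_eq_square algebra_simps)
        also have "\<dots> \<le> real (card (L \<inter> cball z (real j)))"
          by (rule card_cball_ge[OF sep s dens True])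
        finally show ?thesis unfolding eq .
      next
        \<comment> \<open>Averaging over squares requires a radius of at least \<open>s\<close>;
          below it the claimed lower bound is not positive.\<close>
        case False
        then have "real j * (real j - 2 * s) \<le> 0" using s by (intro mult_nonneg_nonpos) auto
        then have "\<gamma> * pi * ((real j)\<^sup>2 - 2 * s * real j) \<le> 0"
          using \<gamma> by (intro mult_nonneg_nonpos) (auto simp: power2_eq_square algebra_simps)
        then show ?thesis by (rule order_trans) simp
      qed
    qed (use n s \<gamma> in \<open>auto simp: dist_norm norm_minus_commute\<close>)
    then have "\<kappa> * (\<Prod>a\<in>L \<inter> cball z R. norm (a - z) / R) \<le> \<kappa> * exp (- (\<gamma> * pi) * (R ^ 2 / 2 - (2 + 2 * s) * R))"
      using pos by (intro mult_left_mono) auto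
    also have "\<dots> \<le> (exp (g * R\<^sup>2) * exp (real d * R)) * exp (- (\<gamma> * pi) * (R ^ 2 / 2 - (2 + 2 * s) * R))"
    proof -
      have "(1 + R) ^ d \<le> exp R ^ d" using R by (intro power_mono exp_ge_add_one_self) auto
      then have "(1 + R) ^ d \<le> exp (real d * R)" by (simp add: exp_of_nat_mult)
      then show ?thesis unfolding \<kappa>_def by (intro mult_right_mono mult_left_mono) auto
    qed
    also have "\<dots> = exp ((real d + \<gamma> * pi * (2 + 2 * s)) * real n - (\<gamma> * pi / 2 - g) * real n ^ 2)"
      by (simp add: R_def flip: exp_add) (simp add: algebra_simps)
    also have "\<dots> \<le> 1 / 2" by (rule small)
    finally show ?thesis .
  qed
  have weighted: "norm (F z) \<le> 2 * K * B' * \<kappa> * ((1 + norm z) ^ d * exp (g * bump T (norm z)))"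
    if T: "T \<ge> 2 * R" for T z
  proof -
    define W where "W w = (1 + norm w) ^ d * exp (g * bump T (norm w))" for w :: complex
    have W: "W w > 0" for w by (simp add: W_def add_pos_nonneg)
    obtain C where C: "\<And>r. r \<ge> 0 \<Longrightarrow> pi / 2 * r\<^sup>2 \<le> g * bump T r + C"
      using bump_dominates_quadratic[of T "pi / 2" g] g T R by auto
    have bdd: "norm (F w) / W w \<le> A * exp C" for w
    proof -
      have "norm (F w) \<le> A * exp (g * bump T (norm w) + C)"
        using C[of "norm w"] A by (intro order_trans[OF growth[of w]] mult_left_mono) auto
      also have "\<dots> = A * exp C * (1 * exp (g * bump T (norm w)))" by (simp add: exp_add)
      also have "\<dots> \<le> A * exp C * W w"
        unfolding W_def using A by (intro mult_left_mono mult_right_mono one_le_power) auto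
      finally show ?thesis using W[of w] by (simp add: pos_divide_le_eq)
    qed
    define V where "V = (SUP w. norm (F w) / W w)"
    have bddV: "bdd_above (range (\<lambda>w. norm (F w) / W w))" using bdd by (auto intro!: bdd_aboveI)
    have V: "norm (F w) \<le> V * W w" for w
    proof -
      have "norm (F w) / W w \<le> V" unfolding V_def by (rule cSUP_upper[OF _ bddV]) auto
      then show ?thesis using W[of w] by (simp add: pos_divide_le_eq)
    qed
    have V0: "V \<ge> 0"
    proof -
      have "0 \<le> V * W 0" using V[of 0] norm_ge_zero order_trans by blast
      then show ?thesis using W[of 0] by (simp add: zero_le_mult_iff)
    qed
    have step: "norm (F z) / W z \<le> V / 2 + K * B' * \<kappa>" for z
    proof -
      obtain E U where E: "open U" "cball z R \<subseteq> U" "E holomorphic_on U" "E z \<noteq> 0"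
        "\<And>w. norm (w - z) \<le> R \<Longrightarrow>
          norm (E w) * exp (g * bump T (norm w)) \<le> exp (g * R\<^sup>2) * (norm (E z) * exp (g * bump T (norm z)))"
        using twisting_factor[of g R T z] g R T by (metis less_imp_le)
      have EW: "norm (E w) * W w \<le> \<kappa> * (norm (E z) * W z)" if w: "norm (w - z) \<le> R" for w
      proof -
        have "norm w \<le> norm z + R" using w norm_triangle_ineq[of "w - z" z] by simp
        moreover have "R * norm z \<ge> 0" using R by simp
        ultimately have "1 + norm w \<le> (1 + R) * (1 + norm z)" by (simp add: algebra_simps)
        then have "(1 + norm w) ^ d \<le> (1 + R) ^ d * (1 + norm z) ^ d"
          unfolding power_mult_distrib[symmetric] by (intro power_mono) auto
        then have "(1 + norm w) ^ d * (norm (E w) * exp (g * bump T (norm w))) \<le>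
          (1 + R) ^ d * (1 + norm z) ^ d * (exp (g * R\<^sup>2) * (norm (E z) * exp (g * bump T (norm z))))"
          using R by (intro mult_mono E(5) w) auto
        then show ?thesis by (simp add: W_def \<kappa>_def mult_ac)
      qed
      define S where "S = L \<inter> cball z R"
      have S: "finite S" unfolding S_def by (rule separated_finite_cball[OF sep])
      define Q where "Q = \<kappa> * (norm (E z) * W z)"
      have Q: "Q > 0" unfolding Q_def using pos E(4) W[of z] by simp
      have "norm (F z * E z) \<le> V * Q * (\<Prod>a\<in>S. norm (a - z) / R) + 2 * (real N * (2 * R / \<delta>) ^ N) * (B' * Q)"
      proof (rule perturbed_jensen_bound[where h = "\<lambda>w. F w * E w", OF S])
        have "real (card S) \<le> ((2 * R + \<delta>) / \<delta>)\<^sup>2"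
          using S R sep by (intro separated_card_le[where z = z]) (auto simp: S_def)
        then show "card S \<le> N" unfolding N_def by linarith
        show "(\<lambda>w. F w * E w) holomorphic_on U"
          using holF E(3) by (intro holomorphic_intros) (auto intro: holomorphic_on_subset)
        show "norm (F w * E w) \<le> V * Q" if "norm (w - z) = R" for w
        proof -
          have "norm (F w * E w) \<le> V * W w * norm (E w)" using V[of w] by (simp add: norm_mult mult_right_mono)
          also have "\<dots> = V * (norm (E w) * W w)" by simp
          also have "\<dots> \<le> V * Q" unfolding Q_def using EW[of w] that V0 by (intro mult_left_mono) auto
          finally show ?thesis .
        qed
        show "norm (F a * E a) \<le> B' * Q" if "a \<in> S" for a
        proof -
          have a: "a \<in> L" "norm (a - z) \<le> R" using that by (auto simp: S_def dist_norm norm_minus_commute)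
          have b0: "bump T (norm a) \<ge> 0"
            using T R by (auto simp: bump_def intro!: tangent_nonneg)
          have "norm (F a) \<le> B' * ((1 + norm a) ^ d * 1)" using B'(2)[OF a(1)] by simp
          also have "\<dots> \<le> B' * W a" unfolding W_def using B'(1) b0 g by (intro mult_left_mono) auto
          finally have "norm (F a * E a) \<le> B' * W a * norm (E a)" by (simp add: norm_mult mult_right_mono)
          also have "\<dots> = B' * (norm (E a) * W a)" by simp
          also have "\<dots> \<le> B' * Q" unfolding Q_def using EW[of a] a B'(1) by (intro mult_left_mono) auto
          finally show ?thesis .
        qed
        show "0 \<le> B' * Q" using B'(1) Q by simp
      qed (use E R sep in \<open>auto simp: S_def\<close>)
      also have "\<dots> = (V * (\<kappa> * (\<Prod>a\<in>S. norm (a - z) / R)) + K * B' * \<kappa>) * (norm (E z) * W z)"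
        by (simp add: K_def Q_def algebra_simps)
      also have "\<dots> \<le> (V * (1 / 2) + K * B' * \<kappa>) * (norm (E z) * W z)"
        using \<rho>[of z] V0 W[of z] unfolding S_def by (intro mult_right_mono add_right_mono mult_left_mono) auto
      finally have "norm (F z) * norm (E z) \<le> ((V / 2 + K * B' * \<kappa>) * W z) * norm (E z)"
        by (simp add: norm_mult mult_ac)
      then have "norm (F z) \<le> (V / 2 + K * B' * \<kappa>) * W z" using E(4) by simp
      then show ?thesis using W[of z] by (simp add: pos_divide_le_eq)
    qed
    \<comment> \<open>\<open>V\<close> is finite because \<open>g\<close> exceeds the type
      \<open>pi / 2\<close> of \<open>F\<close>, so half of it can be absorbed. The remaining bound
      does not depend on \<open>T\<close>.\<close>
    have "V \<le> V / 2 + K * B' * \<kappa>" unfolding V_def using step unfolding V_def by (intro cSUP_least) auto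
    then have "V \<le> 2 * K * B' * \<kappa>" by simp
    then have "V * W z \<le> 2 * K * B' * \<kappa> * W z" using W[of z] by (intro mult_right_mono) auto
    then show ?thesis using V[of z] unfolding W_def by linarith
  qed
  \<comment> \<open>Taking \<open>T\<close> at least \<open>norm z\<close> puts \<open>z\<close>
    where \<open>bump T\<close> vanishes.\<close>
  have "norm (F z) \<le> 2 * K * B' * \<kappa> * (1 + norm z) ^ d" for z
    using weighted[of "max (2 * R) (norm z)" z] by (simp add: bump_def)
  then show ?thesis by blast
qed

section \<open>Polynomials of equal modulus on a relatively dense set\<close>

lemma infinite_unit_circle: "infinite {u::complex. norm u = 1}"
proof -
  have "{u::complex. norm u = 1} = sphere 0 1" by (auto simp: dist_norm)
  moreover have "infinite (sphere (0::complex) 1)"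
  proof
    assume "finite (sphere (0::complex) 1)"
    moreover have "connected (sphere (0::complex) 1)" by (rule connected_sphere) auto
    ultimately have "sphere (0::complex) 1 = {} \<or> (\<exists>a. sphere (0::complex) 1 = {a})"
      using connected_finite_iff_sing by blast
    moreover have "1 \<in> sphere (0::complex) 1" "-1 \<in> sphere (0::complex) 1" by auto
    moreover have "(1::complex) \<noteq> -1" by simp
    ultimately show False by (metis empty_iff singletonD)
  qed
  ultimately show ?thesis by simp
qed

text \<open>Evaluating near \<open>r u\<close> for \<open>r \<rightarrow> \<infinity>\<close> isolates the part of top total degree \<open>m\<close> at the unit vector \<open>u\<close>.\<close>

lemma bivariate_poly_zero_on_relatively_dense:
  fixes c :: "nat \<Rightarrow> nat \<Rightarrow> complex"
  assumes dense: "\<And>z. \<exists>w\<in>L. norm (w - z) \<le> R"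
    and zero: "\<And>w. w \<in> L \<Longrightarrow> (\<Sum>j<n. \<Sum>k<n. c j k * (w ^ j * cnj w ^ k)) = 0"
    and "j < n" "k < n"
  shows "c j k = 0"
proof (rule ccontr)
  assume "c j k \<noteq> 0"
  define D where "D = {j + k | j k. j < n \<and> k < n \<and> c j k \<noteq> 0}"
  have "D \<subseteq> {..2 * n}" unfolding D_def by auto
  then have finD: "finite D" using finite_subset by blast
  have "D \<noteq> {}" using \<open>c j k \<noteq> 0\<close> assms(3,4) unfolding D_def by blast
  define m where "m = Max D"
  have "m \<in> D" unfolding m_def using finD \<open>D \<noteq> {}\<close> by (rule Max_in)
  then obtain j0 k0 where jk0: "j0 < n" "k0 < n" "j0 + k0 = m" "c j0 k0 \<noteq> 0" by (auto simp: D_def)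
  have top: "c j k = 0" if "j < n" "k < n" "j + k > m" for j k
  proof (rule ccontr)
    assume "c j k \<noteq> 0"
    then have "j + k \<in> D" using that by (auto simp: D_def)
    then show False using Max_ge[OF finD] that(3) unfolding m_def by fastforce
  qed
  \<comment> \<open>On the unit circle the top-degree form, multiplied by \<open>u ^ m\<close>,
    becomes a polynomial in \<open>u\<close> alone: for \<open>j + k = m\<close> the factor
    \<open>cnj u ^ k\<close> cancels \<open>u ^ k\<close>, leaving \<open>u ^ (2 * j)\<close>.
    Infinitely many zeros then force \<open>p = 0\<close>.\<close>
  define e where "e j = (\<Sum>k<n. if j + k = m then c j k else 0)" for j
  define p where "p = (\<Sum>j<n. monom (e j) (2 * j))"
  have "poly p u = 0" if u: "norm u = 1" for u
  proof -
    have "\<forall>r::nat. \<exists>w. w \<in> L \<and> norm (w - of_nat r * u) \<le> R" using dense by blast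
    from choice[OF this] obtain w where w: "\<And>r::nat. w r \<in> L" "\<And>r::nat. norm (w r - of_nat r * u) \<le> R" by blast
    define v where "v r = w r / of_nat r" for r
    have "v \<longlonglongrightarrow> u"
    proof (rule LIM_zero_cancel, rule Lim_null_comparison)
      show "eventually (\<lambda>r. norm (v r - u) \<le> R / real r) sequentially"
      proof (rule eventually_mono[OF eventually_gt_at_top[of 0]])
        fix r :: nat assume r: "r > 0"
        have "v r - u = (w r - of_nat r * u) / of_nat r" using r by (simp add: v_def diff_divide_distrib)
        then show "norm (v r - u) \<le> R / real r" using w(2)[of r] r by (simp add: norm_divide divide_right_mono)
      qed
      show "(\<lambda>r. R / real r) \<longlonglongrightarrow> 0" by (rule lim_const_over_n)
    qed
    \<comment> \<open>The limit \<open>0 ^ (m - (j + k))\<close> is 1 for \<open>j + k = m\<close>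
      and 0 for smaller degrees. Truncated subtraction also gives 1 for \<open>j + k > m\<close>,
      but there the coefficients vanish by \<open>top\<close>.\<close>
    have lim: "(\<lambda>r. \<Sum>j<n. \<Sum>k<n. c j k * (v r ^ j * cnj (v r) ^ k * (1 / of_nat r) ^ (m - (j + k))))
       \<longlonglongrightarrow> (\<Sum>j<n. \<Sum>k<n. c j k * (u ^ j * cnj u ^ k * 0 ^ (m - (j + k))))"
      by (intro tendsto_intros \<open>v \<longlonglongrightarrow> u\<close> lim_1_over_n)
    have zero': "(\<Sum>j<n. \<Sum>k<n. c j k * (v r ^ j * cnj (v r) ^ k * (1 / of_nat r) ^ (m - (j + k)))) = 0" if "r > 0" for r
    proof -
      have "c j k * (v r ^ j * cnj (v r) ^ k * (1 / of_nat r) ^ (m - (j + k)))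
          = c j k * (w r ^ j * cnj (w r) ^ k) / of_nat r ^ m" if "j < n" "k < n" for j k
      proof (cases "j + k \<le> m")
        case True
        then have "(of_nat r :: complex) ^ m = of_nat r ^ j * of_nat r ^ k * of_nat r ^ (m - (j + k))"
          by (simp flip: power_add)
        then show ?thesis using \<open>r > 0\<close> by (simp add: v_def power_divide)
      next
        case False
        then show ?thesis using top that by simp
      qed
      then have "(\<Sum>j<n. \<Sum>k<n. c j k * (v r ^ j * cnj (v r) ^ k * (1 / of_nat r) ^ (m - (j + k))))
        = (\<Sum>j<n. \<Sum>k<n. c j k * (w r ^ j * cnj (w r) ^ k)) / of_nat r ^ m"
        by (simp add: sum_divide_distrib)
      then show ?thesis using zero[OF w(1)] by simp
    qed
    have "(\<lambda>r. \<Sum>j<n. \<Sum>k<n. c j k * (v r ^ j * cnj (v r) ^ k * (1 / of_nat r) ^ (m - (j + k)))) \<longlonglongrightarrow> 0"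
      by (rule tendsto_eventually, rule eventually_mono[OF eventually_gt_at_top[of 0]]) (rule zero')
    then have "(\<Sum>j<n. \<Sum>k<n. c j k * (u ^ j * cnj u ^ k * 0 ^ (m - (j + k)))) = 0"
      using lim LIMSEQ_unique by blast
    then have "0 = u ^ m * (\<Sum>j<n. \<Sum>k<n. c j k * (u ^ j * cnj u ^ k * 0 ^ (m - (j + k))))" by simp
    also have "\<dots> = (\<Sum>j<n. \<Sum>k<n. (if j + k = m then c j k else 0) * u ^ (2 * j))"
      unfolding sum_distrib_left
    proof (intro sum.cong refl)
      fix j k assume jk: "j \<in> {..<n}" "k \<in> {..<n}"
      have uk: "u ^ k * cnj u ^ k = 1"
        using u complex_norm_square[of u] by (simp flip: power_mult_distrib)
      consider "j + k > m" | "j + k < m" | "j + k = m" by linarith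
      then show "u ^ m * (c j k * (u ^ j * cnj u ^ k * 0 ^ (m - (j + k)))) = (if j + k = m then c j k else 0) * u ^ (2 * j)"
      proof cases
        case 1 then show ?thesis using top[of j k] jk by simp
      next
        case 2 then show ?thesis by simp
      next
        case 3
        have "u ^ m * (c j k * (u ^ j * cnj u ^ k)) = c j k * (u ^ j * u ^ j) * (u ^ k * cnj u ^ k)"
          unfolding 3[symmetric] power_add by (simp add: mult_ac)
        then show ?thesis using 3 uk by (simp add: mult_2 power_add)
      qed
    qed
    also have "\<dots> = poly p u" by (simp add: p_def e_def poly_sum poly_monom sum_distrib_right)
    finally show ?thesis by simp
  qed
  then have "{u. norm u = 1} \<subseteq> {u. poly p u = 0}" by auto
  then have "p = 0" using infinite_unit_circle poly_roots_finite finite_subset by blast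
  then have "coeff p (2 * j0) = 0" by simp
  moreover have "coeff p (2 * j0) = e j0"
    using jk0 by (simp add: p_def coeff_sum coeff_monom)
  moreover have "e j0 = c j0 k0"
  proof -
    have "e j0 = (\<Sum>k<n. if k = k0 then c j0 k else 0)"
      unfolding e_def using jk0 by (intro sum.cong) auto
    then show ?thesis using jk0 by simp
  qed
  ultimately show False using jk0 by simp
qed

text \<open>The squared modulus has coefficients \<open>a j * cnj (a k)\<close>, a rank-one matrix
  that determines the vector \<open>a\<close> up to a unimodular factor.\<close>

lemma poly_modulus_eq_on_relatively_dense:
  fixes a b :: "nat \<Rightarrow> complex"
  assumes dense: "\<And>z. \<exists>w\<in>L. norm (w - z) \<le> R"
    and eq: "\<And>w. w \<in> L \<Longrightarrow> norm (\<Sum>j<n. a j * w ^ j) = norm (\<Sum>j<n. b j * w ^ j)"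
  shows "\<exists>\<sigma>. norm \<sigma> = 1 \<and> (\<forall>j<n. a j = \<sigma> * b j)"
proof -
  have ab: "a j * cnj (a k) = b j * cnj (b k)" if "j < n" "k < n" for j k
  proof -
    have "a j * cnj (a k) - b j * cnj (b k) = 0"
    proof (rule bivariate_poly_zero_on_relatively_dense[OF dense _ that])
      fix w assume "w \<in> L"
      have ex: "of_real ((norm (\<Sum>j<n. a j * w ^ j))\<^sup>2) = (\<Sum>j<n. \<Sum>k<n. a j * cnj (a k) * (w ^ j * cnj w ^ k))"
        for a :: "nat \<Rightarrow> complex"
        unfolding complex_norm_square by (simp add: sum_product mult_ac)
      have "(\<Sum>j<n. \<Sum>k<n. (a j * cnj (a k) - b j * cnj (b k)) * (w ^ j * cnj w ^ k))
        = of_real ((norm (\<Sum>j<n. a j * w ^ j))\<^sup>2) - of_real ((norm (\<Sum>j<n. b j * w ^ j))\<^sup>2)"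
        unfolding ex by (simp add: left_diff_distrib sum_subtractf)
      also have "\<dots> = 0" using eq[OF \<open>w \<in> L\<close>] by simp
      finally show "(\<Sum>j<n. \<Sum>k<n. (a j * cnj (a k) - b j * cnj (b k)) * (w ^ j * cnj w ^ k)) = 0" .
    qed
    then show ?thesis by simp
  qed
  then have nrm: "norm (a j) = norm (b j)" if "j < n" for j
  proof -
    have "of_real ((norm (a j))\<^sup>2) = (of_real ((norm (b j))\<^sup>2) :: complex)"
      unfolding complex_norm_square using ab[OF that that] .
    then have "(norm (a j))\<^sup>2 = (norm (b j))\<^sup>2" by (simp only: of_real_eq_iff)
    then show ?thesis by (simp add: power2_eq_iff_nonneg)
  qed
  show ?thesis
  proof (cases "\<exists>k<n. b k \<noteq> 0")
    case True
    then obtain k where k: "k < n" "b k \<noteq> 0" by blast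
    then have "a k \<noteq> 0" using nrm[of k] by auto
    \<comment> \<open>The factor is read off from the column of an index \<open>k\<close> with
      \<open>b k \<noteq> 0\<close>.\<close>
    then show ?thesis using ab k nrm[OF k(1)]
      by (intro exI[of _ "cnj (b k) / cnj (a k)"]) (auto simp: norm_divide field_simps)
  next
    case False
    then show ?thesis using nrm by (intro exI[of _ 1]) auto
  qed
qed

section \<open>Density and injectivity in the space of square-integrable functions\<close>

lemma borel_measurable_lebesgueI: "f \<in> borel_measurable borel \<Longrightarrow> f \<in> borel_measurable lebesgue"
  by (simp add: measurable_completion)

text \<open>Completing the square; integrability and the exact integral are then inherited from the
  normal density.\<close>

lemma exp_quadratic_eq_normal_density:
  assumes "c > 0"
  shows "exp (b * t - c * t\<^sup>2) = exp (b\<^sup>2 / (4 * c)) * sqrt (pi / c) * normal_density (b / (2 * c)) (1 / sqrt (2 * c)) t"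
proof -
  have eq: "b * t - c * t\<^sup>2 = b\<^sup>2 / (4 * c) + (- (t - b / (2 * c))\<^sup>2 * c)"
    using assms by (simp add: field_simps power2_eq_square)
  show ?thesis unfolding eq exp_add using assms
    by (simp add: normal_density_def power_divide real_sqrt_divide)
qed

lemma integrable_exp_quadratic:
  assumes "c > 0"
  shows "integrable lebesgue (\<lambda>t::real. exp (b * t - c * t\<^sup>2))"
  using integrable_normal_density[of "b / (2 * c)" "1 / sqrt (2 * c)"] assms
  by (subst integrable_completion) (simp_all add: exp_quadratic_eq_normal_density)

lemma integrable_exp_abs_quadratic:
  assumes "c > 0"
  shows "integrable lebesgue (\<lambda>t::real. exp (b * \<bar>t\<bar> - c * t\<^sup>2))"
proof (rule Bochner_Integration.integrable_bound)
  show "integrable lebesgue (\<lambda>t::real. exp (b * t - c * t\<^sup>2) + exp ((- b) * t - c * t\<^sup>2))"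
    using assms by (intro Bochner_Integration.integrable_add integrable_exp_quadratic)
  show "(\<lambda>t::real. exp (b * \<bar>t\<bar> - c * t\<^sup>2)) \<in> borel_measurable lebesgue"
    by (intro borel_measurable_lebesgueI) measurable
  have "norm (exp (b * \<bar>t\<bar> - c * t\<^sup>2)) \<le> norm (exp (b * t - c * t\<^sup>2) + exp ((- b) * t - c * t\<^sup>2))" for t :: real
    by (cases "t \<ge> 0") auto
  then show "AE t in lebesgue. norm (exp (b * \<bar>t\<bar> - c * t\<^sup>2)) \<le> norm (exp (b * t - c * t\<^sup>2) + exp ((- b) * t - c * t\<^sup>2))"
    by simp
qed

definition gauss :: "real \<Rightarrow> real" where
  "gauss t = exp (- (pi * t\<^sup>2))"

lemma gauss_pos [simp]: "gauss t > 0" "gauss t \<ge> 0" "gauss t \<noteq> 0" "\<bar>gauss t\<bar> = gauss t"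
  by (simp_all add: gauss_def)

lemma continuous_on_gauss [continuous_intros]: "continuous_on A gauss"
  unfolding gauss_def by (intro continuous_intros)

lemma of_real_gauss_measurable: "(\<lambda>t. complex_of_real (gauss t)) \<in> borel_measurable borel"
  by (intro borel_measurable_continuous_onI continuous_intros)

lemma integrable_gauss: "integrable lebesgue gauss"
  using integrable_exp_quadratic[of pi 0] by (simp add: gauss_def[abs_def])

lemma L2_measurable: "f \<in> L2 \<Longrightarrow> f \<in> borel_measurable lebesgue"
  and L2_integrable: "f \<in> L2 \<Longrightarrow> integrable lebesgue (\<lambda>t. (norm (f t))\<^sup>2)"
  by (auto simp: L2_def)

lemma L2_bound:
  assumes "f \<in> borel_measurable lebesgue" "integrable lebesgue h" "\<And>t. (norm (f t))\<^sup>2 \<le> h t"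
  shows "f \<in> L2"
proof -
  have "integrable lebesgue (\<lambda>t. (norm (f t))\<^sup>2)"
  proof (rule Bochner_Integration.integrable_bound[OF assms(2)])
    show "(\<lambda>t. (norm (f t))\<^sup>2) \<in> borel_measurable lebesgue" using assms(1) by measurable
    show "AE t in lebesgue. norm ((norm (f t))\<^sup>2) \<le> norm (h t)"
      using assms(3) by (auto intro: order_trans abs_ge_self)
  qed
  then show ?thesis using assms by (simp add: L2_def)
qed

lemma norm_add_square_le: "(norm (x + y))\<^sup>2 \<le> 2 * (norm x)\<^sup>2 + 2 * (norm (y::complex))\<^sup>2"
proof -
  have "(norm (x + y))\<^sup>2 \<le> (norm x + norm y)\<^sup>2" by (intro power_mono norm_triangle_ineq) auto
  also have "\<dots> \<le> 2 * (norm x)\<^sup>2 + 2 * (norm y)\<^sup>2"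
    using zero_le_power2[of "norm x - norm y"] by (simp add: power2_eq_square algebra_simps)
  finally show ?thesis .
qed

lemma L2_add: "f \<in> L2 \<Longrightarrow> g \<in> L2 \<Longrightarrow> (\<lambda>t. f t + g t) \<in> L2"
  by (rule L2_bound[where h = "\<lambda>t. 2 * (norm (f t))\<^sup>2 + 2 * (norm (g t))\<^sup>2"])
     (auto simp: L2_def norm_add_square_le)

lemma L2_cmult: "f \<in> L2 \<Longrightarrow> (\<lambda>t. c * f t) \<in> L2"
  by (auto simp: L2_def norm_mult power_mult_distrib)

lemma L2_diff: "f \<in> L2 \<Longrightarrow> g \<in> L2 \<Longrightarrow> (\<lambda>t. f t - g t) \<in> L2"
  using L2_add[of f "\<lambda>t. (-1) * g t"] L2_cmult[of g "-1"] by simp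

lemma L2_zero: "(\<lambda>t. 0) \<in> L2"
  by (simp add: L2_def)

lemma L2_sum: "(\<And>i. i \<in> I \<Longrightarrow> f i \<in> L2) \<Longrightarrow> (\<lambda>t. \<Sum>i\<in>I. f i t) \<in> L2"
  by (induction I rule: infinite_finite_induct) (auto simp: L2_zero intro: L2_add)

lemma L2_mult_integrable:
  assumes "f \<in> L2" "g \<in> L2"
  shows "integrable lebesgue (\<lambda>t. f t * g t)"
proof (rule Bochner_Integration.integrable_bound)
  show "integrable lebesgue (\<lambda>t. (norm (f t))\<^sup>2 + (norm (g t))\<^sup>2)"
    using assms by (intro Bochner_Integration.integrable_add L2_integrable)
  show "(\<lambda>t. f t * g t) \<in> borel_measurable lebesgue"
    using assms[THEN L2_measurable] by measurable
  have "norm (f t * g t) \<le> norm ((norm (f t))\<^sup>2 + (norm (g t))\<^sup>2)" for t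
  proof -
    have "2 * (norm (f t) * norm (g t)) \<le> (norm (f t))\<^sup>2 + (norm (g t))\<^sup>2"
      using zero_le_power2[of "norm (f t) - norm (g t)"] by (simp add: power2_eq_square algebra_simps)
    moreover have "norm (f t) * norm (g t) \<ge> 0" by simp
    ultimately show ?thesis unfolding norm_mult real_norm_def by linarith
  qed
  then show "AE t in lebesgue. norm (f t * g t) \<le> norm ((norm (f t))\<^sup>2 + (norm (g t))\<^sup>2)" by simp
qed

lemma L2_poly_gauss_bound:
  assumes "f \<in> borel_measurable borel" "\<And>t. norm (f t) \<le> C * exp (b * \<bar>t\<bar>)"
  shows "(\<lambda>t. f t * of_real (gauss t)) \<in> L2"
proof (rule L2_bound)
  show "(\<lambda>t. f t * of_real (gauss t)) \<in> borel_measurable lebesgue"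
    using assms(1) of_real_gauss_measurable by (intro borel_measurable_lebesgueI) measurable
  show "integrable lebesgue (\<lambda>t. C\<^sup>2 * exp (2 * b * \<bar>t\<bar> - 2 * pi * t\<^sup>2))"
    by (intro integrable_mult_right integrable_exp_abs_quadratic) auto
  fix t
  have "norm (f t * of_real (gauss t)) \<le> C * exp (b * \<bar>t\<bar>) * gauss t"
    using assms(2)[of t] by (simp add: norm_mult mult_right_mono)
  also have "\<dots> = C * exp (b * \<bar>t\<bar> - pi * t\<^sup>2)" by (simp add: gauss_def exp_diff exp_minus field_simps)
  finally have "(norm (f t * of_real (gauss t)))\<^sup>2 \<le> (C * exp (b * \<bar>t\<bar> - pi * t\<^sup>2))\<^sup>2"
    by (intro power_mono) auto
  also have "\<dots> = C\<^sup>2 * exp (2 * b * \<bar>t\<bar> - 2 * pi * t\<^sup>2)"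
    by (simp add: power_mult_distrib flip: exp_double)
  finally show "(norm (f t * of_real (gauss t)))\<^sup>2 \<le> C\<^sup>2 * exp (2 * b * \<bar>t\<bar> - 2 * pi * t\<^sup>2)" .
qed

section \<open>Mean-square approximation by continuous functions of compact support\<close>

definition L2_limit :: "(real \<Rightarrow> complex) set \<Rightarrow> (real \<Rightarrow> complex) \<Rightarrow> bool" where
  "L2_limit S f \<longleftrightarrow> (\<forall>\<epsilon>>0. \<exists>u\<in>S. (LINT t|lebesgue. (norm (f t - u t))\<^sup>2) < \<epsilon>)"

lemma L2_limit_trans:
  assumes f: "f \<in> L2" and "T \<subseteq> L2" "S \<subseteq> L2" "L2_limit T f" "\<And>g. g \<in> T \<Longrightarrow> L2_limit S g"
  shows "L2_limit S f"
  unfolding L2_limit_def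
proof (intro allI impI)
  fix \<epsilon> :: real assume "\<epsilon> > 0"
  \<comment> \<open>Squared distances obey the triangle inequality only up to a factor 2, so two
    errors below \<open>\<epsilon> / 4\<close> add up to less than
    \<open>\<epsilon>\<close>.\<close>
  then obtain g where g: "g \<in> T" "(LINT t|lebesgue. (norm (f t - g t))\<^sup>2) < \<epsilon> / 4"
    using assms(4) by (metis L2_limit_def divide_pos_pos zero_less_numeral)
  obtain u where u: "u \<in> S" "(LINT t|lebesgue. (norm (g t - u t))\<^sup>2) < \<epsilon> / 4"
    using assms(5)[OF g(1)] \<open>\<epsilon> > 0\<close> by (metis L2_limit_def divide_pos_pos zero_less_numeral)
  have fg: "integrable lebesgue (\<lambda>t. (norm (f t - g t))\<^sup>2)" "integrable lebesgue (\<lambda>t. (norm (g t - u t))\<^sup>2)"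
    "integrable lebesgue (\<lambda>t. (norm (f t - u t))\<^sup>2)"
    using assms(2,3) f g(1) u(1) by (auto intro!: L2_integrable L2_diff)
  have "(LINT t|lebesgue. (norm (f t - u t))\<^sup>2) \<le> (LINT t|lebesgue. 2 * (norm (f t - g t))\<^sup>2 + 2 * (norm (g t - u t))\<^sup>2)"
  proof (rule integral_mono)
    show "(norm (f t - u t))\<^sup>2 \<le> 2 * (norm (f t - g t))\<^sup>2 + 2 * (norm (g t - u t))\<^sup>2" for t
      using norm_add_square_le[of "f t - g t" "g t - u t"] by simp
  qed (use fg in auto)
  also have "\<dots> < \<epsilon>" using fg g u by simp
  finally show "\<exists>u\<in>S. (LINT t|lebesgue. (norm (f t - u t))\<^sup>2) < \<epsilon>" using u by blast
qed

lemma L2_limit_sequence: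
  assumes "\<And>n. u n \<in> S" and "\<And>n. u n \<in> borel_measurable lebesgue" "f \<in> borel_measurable lebesgue"
    and "AE t in lebesgue. (\<lambda>n. u n t) \<longlonglongrightarrow> f t"
    and "integrable lebesgue h" "\<And>n t. (norm (f t - u n t))\<^sup>2 \<le> h t"
  shows "L2_limit S f"
  unfolding L2_limit_def
proof (intro allI impI)
  fix \<epsilon> :: real assume "\<epsilon> > 0"
  have "(\<lambda>n. LINT t|lebesgue. (norm (f t - u n t))\<^sup>2) \<longlonglongrightarrow> integral\<^sup>L lebesgue (\<lambda>t::real. 0::real)"
  proof (rule integral_dominated_convergence[where s = "\<lambda>n t. (norm (f t - u n t))\<^sup>2" and w = h])
    show "(\<lambda>t. (norm (f t - u n t))\<^sup>2) \<in> borel_measurable lebesgue" for n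
      using assms(2)[of n] assms(3) by measurable
    show "AE t in lebesgue. (\<lambda>n. (norm (f t - u n t))\<^sup>2) \<longlonglongrightarrow> 0"
      using assms(4)
    proof eventually_elim
      case (elim t)
      have "(\<lambda>n. (norm (f t - u n t))\<^sup>2) \<longlonglongrightarrow> (norm (f t - f t))\<^sup>2"
        by (intro tendsto_intros elim)
      then show ?case by simp
    qed
  qed (use assms(5,6) in auto)
  then have "eventually (\<lambda>n. (LINT t|lebesgue. (norm (f t - u n t))\<^sup>2) < \<epsilon>) sequentially"
    using \<open>\<epsilon> > 0\<close> by (intro order_tendstoD(2)) auto
  then obtain n where "(LINT t|lebesgue. (norm (f t - u n t))\<^sup>2) < \<epsilon>" by (auto simp: eventually_sequentially)
  then show "\<exists>u\<in>S. (LINT t|lebesgue. (norm (f t - u t))\<^sup>2) < \<epsilon>" using assms(1) by blast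
qed

definition Cc :: "(real \<Rightarrow> complex) set" where
  "Cc = {f. continuous_on UNIV f \<and> (\<exists>L. \<forall>t. \<bar>t\<bar> > L \<longrightarrow> f t = 0)}"

lemma Cc_bounded:
  assumes "f \<in> Cc"
  obtains L M where "L > 0" "M > 0" "\<And>t. \<bar>t\<bar> > L \<Longrightarrow> f t = 0" "\<And>t. norm (f t) \<le> M"
proof -
  obtain L where L: "\<forall>t. \<bar>t\<bar> > L \<longrightarrow> f t = 0" using assms by (auto simp: Cc_def)
  have "compact (f ` {-\<bar>L\<bar>..\<bar>L\<bar>})"
    using assms by (intro compact_continuous_image) (auto simp: Cc_def intro: continuous_on_subset)
  then obtain M where M: "M > 0" "\<And>t. t \<in> {-\<bar>L\<bar>..\<bar>L\<bar>} \<Longrightarrow> norm (f t) \<le> M"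
    using compact_imp_bounded bounded_pos by (metis imageI)
  have "norm (f t) \<le> M" for t
  proof (cases "t \<in> {-\<bar>L\<bar>..\<bar>L\<bar>}")
    case False
    then have "\<bar>t\<bar> > L" by auto
    then show ?thesis using L M(1) by simp
  qed (use M in auto)
  then show ?thesis using L M(1) by (intro that[of "\<bar>L\<bar> + 1" M]) auto
qed

lemma integrable_interval_const: "integrable lebesgue (\<lambda>t::real. indicator {a..b} t * (c::real))"
  by (intro integrable_mult_left integrable_real_indicator) (auto simp: emeasure_lborel_Icc_eq)

lemma Cc_subset_L2: "Cc \<subseteq> L2"
proof
  fix f assume f: "f \<in> Cc"
  then obtain L M where LM: "\<And>t. \<bar>t\<bar> > L \<Longrightarrow> f t = 0" "\<And>t. norm (f t) \<le> M" using Cc_bounded by metis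
  show "f \<in> L2"
  proof (rule L2_bound)
    show "f \<in> borel_measurable lebesgue"
      using f by (intro borel_measurable_lebesgueI borel_measurable_continuous_onI) (auto simp: Cc_def)
    show "integrable lebesgue (\<lambda>t. indicator {-L..L} t * M\<^sup>2)" by (rule integrable_interval_const)
    show "(norm (f t))\<^sup>2 \<le> indicator {-L..L} t * M\<^sup>2" for t
    proof (cases "\<bar>t\<bar> > L")
      case False
      then show ?thesis using LM(2)[of t] by (auto simp: indicator_def intro!: power_mono)
    qed (use LM(1) in \<open>auto simp: indicator_def\<close>)
  qed
qed

text \<open>A measurable function is almost everywhere a limit of continuous ones, but these need a
  common dominating function. Projecting their values to a closed disc and multiplying by a
  trapezoidal cutoff provides it without changing the limit.\<close>

lemma L2_limit_bounded_support:
  assumes f: "f \<in> borel_measurable lebesgue" and n: "n \<ge> 0"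
    and supp: "\<And>t. \<bar>t\<bar> > n \<Longrightarrow> f t = 0" and bd: "\<And>t. norm (f t) \<le> n"
  shows "L2_limit Cc f"
proof -
  have "f measurable_on UNIV" using f by (intro lebesgue_measurable_imp_measurable_on) auto
  then obtain N g where g: "negligible N" "\<And>k. continuous_on UNIV (g k)" 
    "\<And>x. x \<notin> N \<Longrightarrow> (\<lambda>k. g k x) \<longlonglongrightarrow> f x"
    by (auto simp: measurable_on_def)
  define cut where "cut t = max 0 (min 1 (n + 1 - \<bar>t\<bar>))" for t :: real
  define c where "c = closest_point (cball (0::complex) n)"
  have contc: "continuous_on UNIV c" unfolding c_def using n by (intro continuous_on_closest_point) auto
  have cself: "c z = z" if "norm z \<le> n" for z unfolding c_def using that by (intro closest_point_self) auto
  have cin: "norm (c z) \<le> n" for z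
    using closest_point_in_set[of "cball 0 n" z] n unfolding c_def by auto
  define u where "u k t = of_real (cut t) * c (g k t)" for k t
  have contu: "continuous_on UNIV (u k)" for k
    unfolding u_def cut_def
    by (intro continuous_intros continuous_on_compose2[OF contc g(2)]) auto
  have cut1: "0 \<le> cut t" "cut t \<le> 1" for t by (auto simp: cut_def)
  have cut0: "cut t = 0" if "\<bar>t\<bar> > n + 1" for t using that by (auto simp: cut_def)
  show ?thesis
  proof (rule L2_limit_sequence)
    show "u k \<in> Cc" for k unfolding Cc_def using contu cut0 by (auto simp: u_def)
    show "u k \<in> borel_measurable lebesgue" for k
      by (intro borel_measurable_lebesgueI borel_measurable_continuous_onI contu)
    show "f \<in> borel_measurable lebesgue" by fact
    have "AE t in lebesgue. t \<notin> N"
      using g(1) by (intro AE_not_in) (simp add: negligible_iff_null_sets)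
    then show "AE t in lebesgue. (\<lambda>k. u k t) \<longlonglongrightarrow> f t"
    proof eventually_elim
      case (elim t)
      have "(\<lambda>k. u k t) \<longlonglongrightarrow> of_real (cut t) * c (f t)"
        unfolding u_def using contc
        by (intro tendsto_intros continuous_on_tendsto_compose[OF contc g(3)[OF elim]]) auto
      moreover have "of_real (cut t) * c (f t) = f t"
        using supp[of t] cself[OF bd[of t]] by (cases "\<bar>t\<bar> > n") (auto simp: cut_def)
      ultimately show ?case by simp
    qed
    show "integrable lebesgue (\<lambda>t. indicator {-(n+1)..n+1} t * (2 * n)\<^sup>2)" by (rule integrable_interval_const)
    show "(norm (f t - u k t))\<^sup>2 \<le> indicator {-(n+1)..n+1} t * (2 * n)\<^sup>2" for k t
    proof (cases "\<bar>t\<bar> > n + 1")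
      case True
      then show ?thesis using supp[of t] cut0[of t] by (simp add: u_def)
    next
      case False
      have "norm (u k t) \<le> 1 * n"
        unfolding u_def norm_mult using cut1[of t] cin by (intro mult_mono) auto
      then have "norm (f t - u k t) \<le> 2 * n"
        using bd[of t] norm_triangle_ineq4[of "f t" "u k t"] by linarith
      then have "(norm (f t - u k t))\<^sup>2 \<le> (2 * n)\<^sup>2" by (intro power_mono) auto
      then show ?thesis using False by (auto simp: indicator_def)
    qed
  qed
qed

text \<open>Truncating in both argument and modulus gives bounded functions of bounded support, with
  error dominated by \<open>f\<close> itself.\<close>

lemma L2_limit_Cc:
  assumes f: "f \<in> L2"
  shows "L2_limit Cc f"
proof -
  define T where "T = {g \<in> L2. L2_limit Cc g}"
  have fm: "f \<in> borel_measurable lebesgue" using f by (rule L2_measurable)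
  define u where "u n t = (if norm (f t) \<le> real n \<and> \<bar>t\<bar> \<le> real n then f t else 0)" for n t
  have um: "u n \<in> borel_measurable lebesgue" for n
  proof -
    have "(\<lambda>t::real. \<bar>t\<bar>) \<in> borel_measurable lebesgue" by (intro borel_measurable_lebesgueI) measurable
    then show ?thesis unfolding u_def using fm by measurable
  qed
  have lim: "L2_limit T f"
  proof (rule L2_limit_sequence)
    show "u n \<in> T" for n
    proof -
      have "u n \<in> L2" by (rule L2_bound[OF um L2_integrable[OF f]]) (auto simp: u_def)
      moreover have "L2_limit Cc (u n)" by (rule L2_limit_bounded_support[OF um, of "real n"]) (auto simp: u_def)
      ultimately show ?thesis by (simp add: T_def)
    qed
    show "AE t in lebesgue. (\<lambda>n. u n t) \<longlonglongrightarrow> f t"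
    proof (rule AE_I2, rule tendsto_eventually)
      fix t
      show "eventually (\<lambda>n. u n t = f t) sequentially"
        using eventually_ge_at_top[of "nat \<lceil>max (norm (f t)) \<bar>t\<bar>\<rceil>"]
      proof eventually_elim
        case (elim n)
        then have "max (norm (f t)) \<bar>t\<bar> \<le> real n" by linarith
        then show ?case by (auto simp: u_def)
      qed
    qed
    show "integrable lebesgue (\<lambda>t. (norm (f t))\<^sup>2)" by (rule L2_integrable[OF f])
    show "(norm (f t - u n t))\<^sup>2 \<le> (norm (f t))\<^sup>2" for n t by (auto simp: u_def)
  qed (use um fm in auto)
  show ?thesis by (rule L2_limit_trans[OF f _ Cc_subset_L2 lim]) (auto simp: T_def)
qed

section \<open>Trigonometric polynomials times the Gaussian\<close>

inductive_set trig_polys :: "(real \<Rightarrow> complex) set" where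
  base: "(\<lambda>t. c * cis (\<omega> * t)) \<in> trig_polys"
| add: "p \<in> trig_polys \<Longrightarrow> q \<in> trig_polys \<Longrightarrow> (\<lambda>t. p t + q t) \<in> trig_polys"

lemma trig_polys_const: "(\<lambda>t. c) \<in> trig_polys"
  using trig_polys.base[of c 0] by simp

lemma trig_polys_base_mult:
  "p \<in> trig_polys \<Longrightarrow> (\<lambda>t. c * cis (\<omega> * t) * p t) \<in> trig_polys"
proof (induction rule: trig_polys.induct)
  case (base d \<nu>)
  have "(\<lambda>t. c * cis (\<omega> * t) * (d * cis (\<nu> * t))) = (\<lambda>t. (c * d) * (cis (\<omega> * t) * cis (\<nu> * t)))"
    by (simp add: mult_ac)
  also have "\<dots> = (\<lambda>t. (c * d) * cis ((\<omega> + \<nu>) * t))"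
    by (simp add: cis_mult distrib_right)
  finally show ?case by (simp only: trig_polys.base)
next
  case (add p q)
  then show ?case using trig_polys.add by (simp add: distrib_left)
qed

lemma trig_polys_mult:
  "p \<in> trig_polys \<Longrightarrow> q \<in> trig_polys \<Longrightarrow> (\<lambda>t. p t * q t) \<in> trig_polys"
proof (induction rule: trig_polys.induct)
  case (base c \<omega>)
  then show ?case by (rule trig_polys_base_mult)
next
  case (add p r)
  then show ?case using trig_polys.add by (simp add: distrib_right)
qed

lemma trig_polys_cmult: "p \<in> trig_polys \<Longrightarrow> (\<lambda>t. c * p t) \<in> trig_polys"
  using trig_polys_base_mult[of p c 0] by simp

text \<open>A real-linear \<open>q\<close> on the circle is a combination of cosine and sine, which
  Euler's formulas split into the frequencies \<open>a\<close> and \<open>- a\<close>; products only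
  add frequencies.\<close>

lemma trig_polys_of_polynomial:
  fixes q :: "complex \<Rightarrow> real"
  assumes "real_polynomial_function q"
  shows "(\<lambda>t. of_real (q (cis (a * t)))) \<in> trig_polys"
  using assms
proof (induction rule: real_polynomial_function.induct)
  case (linear q)
  then interpret bounded_linear q .
  have "of_real (q (cis (a * t))) = (of_real (q 1) / 2 + of_real (q \<i>) / (2 * \<i>)) * cis (a * t)
      + (of_real (q 1) / 2 - of_real (q \<i>) / (2 * \<i>)) * cis ((- a) * t)" for t
  proof -
    have "q (cis (a * t)) = q (cos (a * t) *\<^sub>R 1 + sin (a * t) *\<^sub>R \<i>)"
      by (rule arg_cong[of _ _ q]) (simp add: complex_eq_iff)
    also have "\<dots> = cos (a * t) * q 1 + sin (a * t) * q \<i>" by (simp add: add scaleR)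
    finally show ?thesis by (simp add: complex_eq_iff Re_divide Im_divide power2_eq_square)
  qed
  then show ?case using trig_polys.base[of _ a] trig_polys.base[of _ "- a"] by (simp only: trig_polys.add)
next
  case (const c)
  then show ?case by (rule trig_polys_const)
next
  case (add f g)
  then show ?case using trig_polys.add by simp
next
  case (mult f g)
  then show ?case using trig_polys_mult by simp
qed

lemma trig_polys_of_complex_polynomial:
  fixes g :: "complex \<Rightarrow> complex"
  assumes "polynomial_function g"
  shows "(\<lambda>t. g (cis (a * t))) \<in> trig_polys"
proof -
  have "real_polynomial_function (Re \<circ> g)" "real_polynomial_function (Im \<circ> g)"
    using assms bounded_linear_Re bounded_linear_Im unfolding polynomial_function_def by blast+
  then have "(\<lambda>t. of_real ((Re \<circ> g) (cis (a * t))) + \<i> * of_real ((Im \<circ> g) (cis (a * t)))) \<in> trig_polys"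
    by (intro trig_polys.add trig_polys_cmult trig_polys_of_polynomial)
  then show ?thesis by (simp flip: complex_eq)
qed

lemma trig_polys_bounded:
  assumes "p \<in> trig_polys"
  shows "continuous_on UNIV p" "\<exists>C. \<forall>t. norm (p t) \<le> C"
proof -
  have "continuous_on UNIV p \<and> (\<exists>C. \<forall>t. norm (p t) \<le> C)" using assms
  proof (induction rule: trig_polys.induct)
    case (base c \<omega>)
    have "\<forall>t. norm (c * cis (\<omega> * t)) \<le> norm c" by (simp add: norm_mult)
    moreover have "continuous_on UNIV (\<lambda>t. c * cis (\<omega> * t))" by (intro continuous_intros)
    ultimately show ?case by blast
  next
    case (add p q)
    then obtain C D where "\<And>t. norm (p t) \<le> C" "\<And>t. norm (q t) \<le> D" by blast
    then have "\<forall>t. norm (p t + q t) \<le> C + D" by (meson add_mono norm_triangle_ineq order_trans)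
    then show ?case using add.IH by (auto intro!: continuous_on_add)
  qed
  then show "continuous_on UNIV p" "\<exists>C. \<forall>t. norm (p t) \<le> C" by auto
qed

lemma trig_gauss_L2:
  assumes "p \<in> trig_polys"
  shows "(\<lambda>t. p t * of_real (gauss t)) \<in> L2"
proof -
  obtain C where "\<And>t. norm (p t) \<le> C" using trig_polys_bounded[OF assms] by blast
  then show ?thesis using trig_polys_bounded(1)[OF assms]
    by (intro L2_poly_gauss_bound[where b = 0 and C = C] borel_measurable_continuous_onI) auto
qed

definition trig_gauss :: "(real \<Rightarrow> complex) set" where
  "trig_gauss = (\<lambda>p t. p t * of_real (gauss t)) ` trig_polys"

lemma trig_gauss_subset_L2: "trig_gauss \<subseteq> L2"
  using trig_gauss_L2 by (auto simp: trig_gauss_def)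

text \<open>The support \<open>[-A/2, A/2]\<close> is wound onto the right half of the unit circle by
  \<open>t \<mapsto> cis (\<pi> t / A)\<close>, where \<open>arcsin\<close> of the imaginary part is a continuous inverse.\<close>

lemma trig_poly_approximation:
  assumes H: "continuous_on UNIV (H :: real \<Rightarrow> complex)" and A: "A > 0"
    and supp: "\<And>t. \<bar>t\<bar> \<ge> A / 2 \<Longrightarrow> H t = 0" and bd: "\<And>t. norm (H t) \<le> M" and e: "e > 0"
  obtains p where "p \<in> trig_polys" "\<And>t. \<bar>t\<bar> \<le> A / 2 \<Longrightarrow> norm (H t - p t) \<le> e" "\<And>t. norm (p t) \<le> M + e"
proof -
  define \<Psi> where "\<Psi> z = (if Re z \<ge> 0 then H (A / pi * arcsin (Im z)) else 0)" for z
  have "continuous_on (({z. Re z \<ge> 0} \<inter> sphere 0 1) \<union> ({z. Re z \<le> 0} \<inter> sphere 0 1)) \<Psi>"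
    unfolding \<Psi>_def
  proof (rule continuous_on_If)
    show "closed ({z. Re z \<ge> 0} \<inter> sphere (0::complex) 1)" "closed ({z. Re z \<le> 0} \<inter> sphere (0::complex) 1)"
      by (auto intro!: closed_Int closed_halfspace_Re_ge closed_halfspace_Re_le)
    have im: "-1 \<le> Im z \<and> Im z \<le> 1" if "z \<in> sphere 0 1" for z
      using that abs_Im_le_cmod[of z] by (simp add: abs_le_iff)
    show "continuous_on ({z. Re z \<ge> 0} \<inter> sphere 0 1) (\<lambda>z. H (A / pi * arcsin (Im z)))"
      by (intro continuous_on_compose2[OF H] continuous_intros) (use im in auto)
    fix z :: complex assume "z \<in> {z. Re z \<ge> 0} \<inter> sphere 0 1" "\<not> 0 \<le> Re z"
    then show "H (A / pi * arcsin (Im z)) = 0" by simp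
  next
    fix z :: complex assume "z \<in> {z. Re z \<le> 0} \<inter> sphere 0 1" "0 \<le> Re z"
    \<comment> \<open>The half-circles meet at \<open>\<i>\<close> and \<open>- \<i>\<close>, the
      images of \<open>A / 2\<close> and \<open>- A / 2\<close>, where \<open>H\<close> vanishes.
      Hence the two pieces of \<open>\<Psi>\<close> agree.\<close>
    then have "Re z = 0" "norm z = 1" by auto
    then have "Im z = 1 \<or> Im z = -1" using cmod_power2[of z] by (simp add: power2_eq_1_iff)
    then have "\<bar>A / pi * arcsin (Im z)\<bar> = A / 2" using A by auto
    then show "H (A / pi * arcsin (Im z)) = 0" by (intro supp) simp
  qed (auto intro!: continuous_intros)
  then have cont: "continuous_on (sphere 0 1) \<Psi>" by (rule continuous_on_subset) auto
  obtain g where g: "polynomial_function g" "\<And>z. z \<in> sphere 0 1 \<Longrightarrow> norm (\<Psi> z - g z) < e"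
    using Stone_Weierstrass_polynomial_function[OF _ cont e] by auto
  define p where "p t = g (cis (pi / A * t))" for t
  have close: "norm (\<Psi> (cis (pi / A * t)) - p t) < e" for t unfolding p_def by (rule g) simp
  show ?thesis
  proof (rule that[of p])
    show "p \<in> trig_polys" unfolding p_def by (rule trig_polys_of_complex_polynomial[OF g(1)])
    fix t
    \<comment> \<open>The bound holds on the whole line, since \<open>p\<close> depends on
      \<open>t\<close> only through a point of the circle.\<close>
    have "M \<ge> 0" using bd[of 0] norm_ge_zero order_trans by blast
    then have "norm (\<Psi> (cis (pi / A * t))) \<le> M" using bd by (auto simp: \<Psi>_def)
    then show "norm (p t) \<le> M + e"
      using close[of t] norm_triangle_sub[of "p t" "\<Psi> (cis (pi / A * t))"] by (simp add: norm_minus_commute)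
  next
    fix t assume t: "\<bar>t\<bar> \<le> A / 2"
    then have "\<bar>pi / A * t\<bar> \<le> pi / 2" using A by (simp add: abs_mult field_simps)
    then have r: "- (pi / 2) \<le> pi / A * t" "pi / A * t \<le> pi / 2" by linarith+
    then have "\<Psi> (cis (pi / A * t)) = H (A / pi * (pi / A * t))"
      by (simp only: \<Psi>_def cis.simps arcsin_sin cos_ge_zero if_True)
    then have "\<Psi> (cis (pi / A * t)) = H t" using A by simp
    then show "norm (H t - p t) \<le> e" using close[of t] by simp
  qed
qed

text \<open>Dividing by the Gaussian keeps compact support, so the quotient is uniformly
  approximable on a long interval. Outside it the approximant is merely bounded, and the Gaussian
  tail makes the error small.\<close>

lemma L2_limit_trig_gauss_Cc:
  assumes "\<phi> \<in> Cc"
  shows "L2_limit trig_gauss \<phi>"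
  unfolding L2_limit_def
proof (intro allI impI)
  fix \<epsilon> :: real assume \<epsilon>: "\<epsilon> > 0"
  define J where "J = (LINT t|lebesgue. gauss t)"
  have J: "J \<ge> 0" unfolding J_def by (intro Bochner_Integration.integral_nonneg) simp
  define H where "H t = \<phi> t / of_real (gauss t)" for t
  have "continuous_on UNIV H"
    using assms unfolding H_def Cc_def by (intro continuous_intros) auto
  moreover have "H \<in> Cc" using assms calculation by (auto simp: Cc_def H_def)
  ultimately obtain L M where H: "continuous_on UNIV H" "L > 0" "M > 0" "\<And>t. \<bar>t\<bar> > L \<Longrightarrow> H t = 0" "\<And>t. norm (H t) \<le> M"
    using Cc_bounded by metis
  define \<eta> where "\<eta> = min 1 (sqrt (\<epsilon> / (4 * (J + 1))))"
  have \<eta>: "\<eta> > 0" "\<eta> \<le> 1" using \<epsilon> J by (auto simp: \<eta>_def)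
  have \<eta>2: "\<eta>\<^sup>2 \<le> \<epsilon> / (4 * (J + 1))"
  proof -
    have "\<eta>\<^sup>2 \<le> (sqrt (\<epsilon> / (4 * (J + 1))))\<^sup>2" using \<eta> by (intro power_mono) (auto simp: \<eta>_def)
    then show ?thesis using \<epsilon> J by simp
  qed
  \<comment> \<open>Of the two factors \<open>gauss t\<close> in the squared error, one is spent on
    making the tail small and the other is kept for integrability. Dividing by \<open>J + 1\<close>
    makes the final integral less than \<open>\<epsilon>\<close>.\<close>
  have "((\<lambda>A. (M + 1)\<^sup>2 * exp (- (pi * A\<^sup>2 / 4))) \<longlongrightarrow> 0) at_top" by real_asymp
  then have "eventually (\<lambda>A. (M + 1)\<^sup>2 * exp (- (pi * A\<^sup>2 / 4)) < \<epsilon> / (4 * (J + 1))) at_top"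
    using \<epsilon> J by (intro order_tendstoD(2)) auto
  then have "eventually (\<lambda>A. (M + 1)\<^sup>2 * exp (- (pi * A\<^sup>2 / 4)) < \<epsilon> / (4 * (J + 1)) \<and> A > 2 * L) at_top"
    using eventually_gt_at_top eventually_conj by blast
  then obtain A where A: "(M + 1)\<^sup>2 * exp (- (pi * A\<^sup>2 / 4)) < \<epsilon> / (4 * (J + 1))" "A > 2 * L"
    using eventually_happens by fastforce
  obtain p where p: "p \<in> trig_polys" "\<And>t. \<bar>t\<bar> \<le> A / 2 \<Longrightarrow> norm (H t - p t) \<le> \<eta>" "\<And>t. norm (p t) \<le> M + \<eta>"
    using trig_poly_approximation[OF H(1), of A M \<eta>] A H \<eta> by auto
  define u where "u t = p t * of_real (gauss t)" for t
  have u: "u \<in> trig_gauss" using p(1) unfolding trig_gauss_def u_def by auto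
  have ptw: "(norm (\<phi> t - u t))\<^sup>2 \<le> \<epsilon> / (2 * (J + 1)) * gauss t" for t
  proof -
    have "\<phi> t - u t = (H t - p t) * of_real (gauss t)" by (simp add: H_def u_def algebra_simps)
    then have eq: "(norm (\<phi> t - u t))\<^sup>2 = (norm (H t - p t))\<^sup>2 * gauss t * gauss t"
      by (simp add: norm_mult power_mult_distrib power2_eq_square)
    have gle: "gauss t \<le> 1" by (simp add: gauss_def)
    show ?thesis
    proof (cases "\<bar>t\<bar> \<le> A / 2")
      case True
      have "(norm (H t - p t))\<^sup>2 * gauss t * gauss t \<le> \<eta>\<^sup>2 * 1 * gauss t"
        using p(2)[OF True] gle by (intro mult_mono power_mono) auto
      also have "\<dots> \<le> \<epsilon> / (2 * (J + 1)) * gauss t"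
      proof -
        have "\<epsilon> / (4 * (J + 1)) \<le> \<epsilon> / (2 * (J + 1))" using \<epsilon> J by (intro divide_left_mono) auto
        then show ?thesis using \<eta>2 by (intro mult_right_mono) auto
      qed
      finally show ?thesis unfolding eq .
    next
      case False
      then have "H t = 0" using A H by auto
      then have "norm (H t - p t) \<le> M + 1" using p(3)[of t] \<eta> by simp
      moreover have "gauss t \<le> exp (- (pi * A\<^sup>2 / 4))"
      proof -
        have "(A / 2)\<^sup>2 \<le> \<bar>t\<bar>\<^sup>2" using False A H by (intro power_mono) auto
        then have "pi * (A\<^sup>2 / 4) \<le> pi * t\<^sup>2" by (intro mult_left_mono) (auto simp: power_divide)
        then show ?thesis by (simp add: gauss_def)
      qed
      ultimately have "(norm (H t - p t))\<^sup>2 * gauss t * gauss t \<le> (M + 1)\<^sup>2 * exp (- (pi * A\<^sup>2 / 4)) * gauss t"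
        by (intro mult_mono power_mono) auto
      also have "\<dots> \<le> \<epsilon> / (2 * (J + 1)) * gauss t"
      proof -
        have "\<epsilon> / (4 * (J + 1)) \<le> \<epsilon> / (2 * (J + 1))" using \<epsilon> J by (intro divide_left_mono) auto
        then show ?thesis using A by (intro mult_right_mono) auto
      qed
      finally show ?thesis unfolding eq .
    qed
  qed
  have "\<phi> \<in> L2" "u \<in> L2" using assms u Cc_subset_L2 trig_gauss_subset_L2 by auto
  then have "(LINT t|lebesgue. (norm (\<phi> t - u t))\<^sup>2) \<le> (LINT t|lebesgue. \<epsilon> / (2 * (J + 1)) * gauss t)"
    using ptw by (intro integral_mono L2_integrable L2_diff integrable_mult_right integrable_gauss)
  also have "\<dots> = \<epsilon> / 2 * (J / (J + 1))" unfolding J_def by simp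
  also have "\<dots> \<le> \<epsilon> / 2 * 1" using \<epsilon> J by (intro mult_left_mono) auto
  also have "\<dots> < \<epsilon>" using \<epsilon> by simp
  finally show "\<exists>u\<in>trig_gauss. (LINT t|lebesgue. (norm (\<phi> t - u t))\<^sup>2) < \<epsilon>" using u by blast
qed

lemma L2_limit_trig_gauss: "f \<in> L2 \<Longrightarrow> L2_limit trig_gauss f"
  using L2_limit_trans[OF _ Cc_subset_L2 trig_gauss_subset_L2 L2_limit_Cc L2_limit_trig_gauss_Cc] by blast

text \<open>By orthogonality the squared norms of \<open>f\<close> and \<open>u\<close> add up to
  that of \<open>f - u\<close>, so the norm of \<open>f\<close> is at most its distance to any
  \<open>u\<close> in \<open>S\<close>.\<close>

lemma L2_eq_zero_if_orthogonal:
  assumes f: "f \<in> L2" and S: "S \<subseteq> L2" "L2_limit S f"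
    and orth: "\<And>u. u \<in> S \<Longrightarrow> (LINT t|lebesgue. f t * cnj (u t)) = 0"
  shows "AE t in lebesgue. f t = 0"
proof -
  have cnjL2: "(\<lambda>t. cnj (u t)) \<in> L2" if "u \<in> L2" for u
    using that by (auto simp: L2_def intro: measurable_compose[OF _ borel_measurable_continuous_onI[of cnj]] continuous_intros)
  have "(LINT t|lebesgue. (norm (f t))\<^sup>2) < \<epsilon>" if \<epsilon>: "\<epsilon> > 0" for \<epsilon>
  proof -
    obtain u where u: "u \<in> S" "(LINT t|lebesgue. (norm (f t - u t))\<^sup>2) < \<epsilon>"
      using S(2) \<epsilon> by (auto simp: L2_limit_def)
    then have uL: "u \<in> L2" using S by auto
    have i: "integrable lebesgue (\<lambda>t. f t * cnj (u t))" by (intro L2_mult_integrable f cnjL2 uL)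
    have "(LINT t|lebesgue. (norm (f t))\<^sup>2) \<le> (LINT t|lebesgue. (norm (f t))\<^sup>2 + (norm (u t))\<^sup>2)"
      using f uL by (intro integral_mono Bochner_Integration.integrable_add L2_integrable) auto
    also have "\<dots> = (LINT t|lebesgue. (norm (f t - u t))\<^sup>2 + 2 * Re (f t * cnj (u t)))"
      unfolding cmod_power2 by (intro Bochner_Integration.integral_cong) (auto simp: power2_eq_square algebra_simps)
    also have "\<dots> = (LINT t|lebesgue. (norm (f t - u t))\<^sup>2) + 2 * Re (LINT t|lebesgue. f t * cnj (u t))"
      using f uL i by (subst Bochner_Integration.integral_add)
        (simp_all only: L2_integrable L2_diff integrable_mult_right integrable_Re integral_mult_right_zero integral_Re)
    also have "\<dots> < \<epsilon>" using u orth by simp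
    finally show ?thesis .
  qed
  then have "(LINT t|lebesgue. (norm (f t))\<^sup>2) \<le> 0" by (meson linorder_not_less order_less_irrefl)
  moreover have "(LINT t|lebesgue. (norm (f t))\<^sup>2) \<ge> 0" by (intro Bochner_Integration.integral_nonneg) simp
  ultimately have "(LINT t|lebesgue. (norm (f t))\<^sup>2) = 0" by simp
  then have "AE t in lebesgue. (norm (f t))\<^sup>2 = 0"
    using integral_nonneg_eq_0_iff_AE[OF L2_integrable[OF f]] by simp
  then show ?thesis by simp
qed

text \<open>The hypothesis says that \<open>f\<close> is orthogonal to every character times the
  Gaussian; finite sums of these are dense.\<close>

lemma fourier_injective:
  assumes f: "f \<in> L2" and ft: "\<And>\<omega>. (LINT t|lebesgue. f t * of_real (gauss t) * cis (\<omega> * t)) = 0"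
  shows "AE t in lebesgue. f t = 0"
proof (rule L2_eq_zero_if_orthogonal[OF f trig_gauss_subset_L2 L2_limit_trig_gauss[OF f]])
  fix u assume "u \<in> trig_gauss"
  then obtain p where p: "p \<in> trig_polys" "u = (\<lambda>t. p t * of_real (gauss t))" by (auto simp: trig_gauss_def)
  have "(LINT t|lebesgue. f t * (cnj (p t) * of_real (gauss t))) = 0 \<and>
      integrable lebesgue (\<lambda>t. f t * (cnj (p t) * of_real (gauss t)))"
    using p(1)
  proof (induction rule: trig_polys.induct)
    case (base c \<omega>)
    have eq: "(\<lambda>t. f t * (cnj (c * cis (\<omega> * t)) * of_real (gauss t))) =
        (\<lambda>t. cnj c * (f t * of_real (gauss t) * cis ((- \<omega>) * t)))" by (simp add: cis_cnj mult_ac)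
    have "(\<lambda>t. 1 * cis ((-\<omega>) * t)) \<in> trig_polys" by (rule trig_polys.base)
    then have "integrable lebesgue (\<lambda>t. f t * ((1 * cis ((-\<omega>) * t)) * of_real (gauss t)))"
      by (intro L2_mult_integrable f trig_gauss_L2)
    then have "integrable lebesgue (\<lambda>t. cnj c * (f t * of_real (gauss t) * cis ((- \<omega>) * t)))"
      by (intro integrable_mult_right) (simp add: mult_ac)
    then show ?case unfolding eq using ft[of "-\<omega>"] by simp
  next
    case (add p q)
    then show ?case by (simp add: distrib_left distrib_right)
  qed
  then show "(LINT t|lebesgue. f t * cnj (u t)) = 0" by (simp add: p(2))
qed

section \<open>Polynomials times the Gaussian\<close>

lemma power_le_exp_abs: "\<bar>t :: real\<bar> ^ n \<le> exp (real n * \<bar>t\<bar>)"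
proof -
  have "\<bar>t\<bar> \<le> exp \<bar>t\<bar>" using exp_ge_add_one_self[of "\<bar>t\<bar>"] by linarith
  then have "\<bar>t\<bar> ^ n \<le> exp \<bar>t\<bar> ^ n" by (intro power_mono) auto
  then show ?thesis by (simp add: exp_of_nat_mult)
qed

lemma norm_exp_partial_sum_le: "norm (\<Sum>n<N. z ^ n / fact n) \<le> exp (norm (z :: complex))"
proof -
  have "norm (\<Sum>n<N. z ^ n / fact n) \<le> (\<Sum>n<N. norm z ^ n / fact n)"
    by (rule order_trans[OF norm_sum]) (simp add: norm_divide norm_power)
  also have "\<dots> \<le> exp (norm z)"
    using summable_exp[of "norm z"] unfolding exp_def
    by (auto intro!: sum_le_suminf simp: divide_inverse mult_ac scaleR_conv_of_real)
  finally show ?thesis .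
qed

lemma exp_partial_sums: "(\<lambda>N. \<Sum>n<N. z ^ n / fact n) \<longlonglongrightarrow> exp (z :: complex)"
  using exp_converges[of z] unfolding sums_def by (simp add: scaleR_conv_of_real divide_inverse mult.commute)

definition poly_gauss :: "complex poly \<Rightarrow> real \<Rightarrow> complex" where
  "poly_gauss p t = poly p (of_real t) * of_real (gauss t)"

lemma poly_exp_bound: "\<exists>C b. \<forall>t. norm (poly p (complex_of_real t)) \<le> C * exp (b * \<bar>t\<bar>)"
proof (induction p)
  case 0
  show ?case by (intro exI[of _ 0]) simp
next
  case (pCons a p)
  then obtain C b where Cb: "\<And>t. norm (poly p (complex_of_real t)) \<le> C * exp (b * \<bar>t\<bar>)" by blast
  have "norm (poly p 0) \<le> C" using Cb[of 0] by simp
  then have C: "C \<ge> 0" by (rule order_trans[OF norm_ge_zero])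
  have "norm (poly (pCons a p) (complex_of_real t)) \<le> (norm a + C) * exp ((\<bar>b\<bar> + 1) * \<bar>t\<bar>)" for t
  proof -
    have "norm (poly (pCons a p) (complex_of_real t)) \<le> norm a + \<bar>t\<bar> * norm (poly p (complex_of_real t))"
      by (simp add: norm_triangle_le norm_mult)
    also have "\<dots> \<le> norm a * exp ((\<bar>b\<bar> + 1) * \<bar>t\<bar>) + exp \<bar>t\<bar> * (C * exp (\<bar>b\<bar> * \<bar>t\<bar>))"
    proof (intro add_mono mult_mono)
      show "norm a \<le> norm a * exp ((\<bar>b\<bar> + 1) * \<bar>t\<bar>)" by (simp add: mult_le_cancel_left1)
      show "\<bar>t\<bar> \<le> exp \<bar>t\<bar>" using exp_ge_add_one_self[of "\<bar>t\<bar>"] by linarith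
      have "b * \<bar>t\<bar> \<le> \<bar>b\<bar> * \<bar>t\<bar>" by (intro mult_right_mono) auto
      then have "C * exp (b * \<bar>t\<bar>) \<le> C * exp (\<bar>b\<bar> * \<bar>t\<bar>)" using C by (intro mult_left_mono) auto
      then show "norm (poly p (complex_of_real t)) \<le> C * exp (\<bar>b\<bar> * \<bar>t\<bar>)" using Cb[of t] by linarith
    qed auto
    also have "\<dots> = (norm a + C) * exp ((\<bar>b\<bar> + 1) * \<bar>t\<bar>)" by (simp add: distrib_right exp_add algebra_simps)
    finally show ?thesis .
  qed
  then show ?case by blast
qed

lemma poly_gauss_L2: "poly_gauss p \<in> L2"
proof -
  obtain C b where "\<And>t. norm (poly p (complex_of_real t)) \<le> C * exp (b * \<bar>t\<bar>)" using poly_exp_bound by blast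
  then show ?thesis unfolding poly_gauss_def[abs_def]
    by (intro L2_poly_gauss_bound[where C = C and b = b] borel_measurable_continuous_onI continuous_intros)
qed

text \<open>The Taylor polynomials of a character are bounded by
  \<open>exp (\<bar>\<omega>\<bar> * \<bar>t\<bar>)\<close> uniformly in the degree, and the
  Gaussian makes this a square-integrable majorant.\<close>

lemma L2_limit_poly_gauss_trig:
  assumes "g \<in> trig_gauss"
  shows "L2_limit (range poly_gauss) g"
proof -
  obtain p where p: "p \<in> trig_polys" "g = (\<lambda>t. p t * of_real (gauss t))" using assms by (auto simp: trig_gauss_def)
  have "L2_limit (range poly_gauss) (\<lambda>t. p t * of_real (gauss t))" using p(1)
  proof (induction rule: trig_polys.induct)
    case (base c \<omega>)
    define q where "q N = (\<Sum>n<N. monom (c * (\<i> * of_real \<omega>) ^ n / fact n) n)" for N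
    have q: "poly (q N) (of_real t) = c * (\<Sum>n<N. (\<i> * of_real (\<omega> * t)) ^ n / fact n)" for N t
      by (simp add: q_def poly_sum poly_monom sum_distrib_left power_mult_distrib mult_ac)
    have cis: "cis (\<omega> * t) = exp (\<i> * of_real (\<omega> * t))" for t by (simp add: cis_conv_exp)
    show ?case
    proof (rule L2_limit_sequence)
      show "poly_gauss (q N) \<in> range poly_gauss" for N by simp
      show "poly_gauss (q N) \<in> borel_measurable lebesgue" for N by (rule L2_measurable[OF poly_gauss_L2])
      show "(\<lambda>t. c * cis (\<omega> * t) * complex_of_real (gauss t)) \<in> borel_measurable lebesgue"
        by (rule L2_measurable[OF trig_gauss_L2[OF trig_polys.base]])
      show "AE t in lebesgue. (\<lambda>N. poly_gauss (q N) t) \<longlonglongrightarrow> c * cis (\<omega> * t) * of_real (gauss t)"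
        unfolding poly_gauss_def q cis by (intro AE_I2 tendsto_intros exp_partial_sums)
      show "integrable lebesgue (\<lambda>t. (2 * norm c)\<^sup>2 * exp ((2 * \<bar>\<omega>\<bar>) * \<bar>t\<bar> - 2 * pi * t\<^sup>2))"
        by (intro integrable_mult_right integrable_exp_abs_quadratic) simp
      fix N t
      have "norm (c * cis (\<omega> * t) * of_real (gauss t) - poly_gauss (q N) t)
          = norm c * norm (cis (\<omega> * t) - (\<Sum>n<N. (\<i> * of_real (\<omega> * t)) ^ n / fact n)) * gauss t"
        unfolding poly_gauss_def q left_diff_distrib[symmetric] right_diff_distrib[symmetric] mult.assoc[symmetric]
        by (simp add: norm_mult)
      also have "\<dots> \<le> norm c * (2 * exp (\<bar>\<omega>\<bar> * \<bar>t\<bar>)) * gauss t"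
      proof (intro mult_left_mono mult_right_mono)
        have "norm (\<Sum>n<N. (\<i> * complex_of_real (\<omega> * t)) ^ n / fact n) \<le> exp (\<bar>\<omega>\<bar> * \<bar>t\<bar>)"
          using norm_exp_partial_sum_le[of "\<i> * complex_of_real (\<omega> * t)" N] by (simp add: norm_mult abs_mult)
        moreover have "norm (cis (\<omega> * t)) \<le> exp (\<bar>\<omega>\<bar> * \<bar>t\<bar>)" by simp
        ultimately show "norm (cis (\<omega> * t) - (\<Sum>n<N. (\<i> * complex_of_real (\<omega> * t)) ^ n / fact n)) \<le> 2 * exp (\<bar>\<omega>\<bar> * \<bar>t\<bar>)"
          using norm_triangle_ineq4[of "cis (\<omega> * t)"] by (smt (verit))
      qed auto
      also have "\<dots> = 2 * norm c * exp (\<bar>\<omega>\<bar> * \<bar>t\<bar> - pi * t\<^sup>2)"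
        by (simp add: gauss_def exp_diff exp_minus field_simps)
      finally have "(norm (c * cis (\<omega> * t) * of_real (gauss t) - poly_gauss (q N) t))\<^sup>2
          \<le> (2 * norm c * exp (\<bar>\<omega>\<bar> * \<bar>t\<bar> - pi * t\<^sup>2))\<^sup>2" by (intro power_mono) auto
      also have "\<dots> = (2 * norm c)\<^sup>2 * exp ((2 * \<bar>\<omega>\<bar>) * \<bar>t\<bar> - 2 * pi * t\<^sup>2)"
        by (simp add: power_mult_distrib algebra_simps flip: exp_double)
      finally show "(norm (c * cis (\<omega> * t) * of_real (gauss t) - poly_gauss (q N) t))\<^sup>2
          \<le> (2 * norm c)\<^sup>2 * exp ((2 * \<bar>\<omega>\<bar>) * \<bar>t\<bar> - 2 * pi * t\<^sup>2)" .
    qed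
  next
    case (add p q)
    show ?case unfolding L2_limit_def
    proof (intro allI impI)
      fix \<epsilon> :: real assume "\<epsilon> > 0"
      then have \<epsilon>4: "\<epsilon> / 4 > 0" by simp
      obtain a where a: "(LINT t|lebesgue. (norm (p t * of_real (gauss t) - poly_gauss a t))\<^sup>2) < \<epsilon> / 4"
        using add.IH(1) \<epsilon>4 unfolding L2_limit_def by blast
      obtain b where b: "(LINT t|lebesgue. (norm (q t * of_real (gauss t) - poly_gauss b t))\<^sup>2) < \<epsilon> / 4"
        using add.IH(2) \<epsilon>4 unfolding L2_limit_def by blast
      have ia: "(\<lambda>t. p t * of_real (gauss t) - poly_gauss a t) \<in> L2"
        using add.hyps by (intro L2_diff trig_gauss_L2 poly_gauss_L2)
      have ib: "(\<lambda>t. q t * of_real (gauss t) - poly_gauss b t) \<in> L2"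
        using add.hyps by (intro L2_diff trig_gauss_L2 poly_gauss_L2)
      have split: "(p t + q t) * of_real (gauss t) - poly_gauss (a + b) t =
         (p t * of_real (gauss t) - poly_gauss a t) + (q t * of_real (gauss t) - poly_gauss b t)" for t
        by (simp add: poly_gauss_def algebra_simps)
      have "(LINT t|lebesgue. (norm ((p t + q t) * of_real (gauss t) - poly_gauss (a + b) t))\<^sup>2)
        \<le> (LINT t|lebesgue. 2 * (norm (p t * of_real (gauss t) - poly_gauss a t))\<^sup>2 +
              2 * (norm (q t * of_real (gauss t) - poly_gauss b t))\<^sup>2)"
        unfolding split using ia ib
        by (intro integral_mono L2_integrable L2_add norm_add_square_le
            Bochner_Integration.integrable_add integrable_mult_right)
      also have "\<dots> < \<epsilon>" using a b L2_integrable[OF ia] L2_integrable[OF ib] by simp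
      finally show "\<exists>u\<in>range poly_gauss. (LINT t|lebesgue. (norm ((p t + q t) * of_real (gauss t) - u t))\<^sup>2) < \<epsilon>"
        by blast
    qed
  qed
  then show ?thesis by (simp add: p(2))
qed

lemma L2_limit_poly_gauss: "f \<in> L2 \<Longrightarrow> L2_limit (range poly_gauss) f"
  by (rule L2_limit_trans[OF _ trig_gauss_subset_L2 _ L2_limit_trig_gauss L2_limit_poly_gauss_trig])
     (auto simp: poly_gauss_L2)

text \<open>Expanding the exponential and interchanging sum and integral by dominated convergence
  gives a power series, with the moments of \<open>h\<close> as coefficients, that converges at
  every \<open>z\<close>.\<close>

lemma laplace_transform_entire:
  fixes h :: "real \<Rightarrow> complex"
  assumes int: "\<And>b. integrable lebesgue (\<lambda>t. norm (h t) * exp (b * \<bar>t\<bar>))" and h: "h \<in> borel_measurable lebesgue"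
  shows "(\<lambda>z. LINT t|lebesgue. h t * exp (of_real t * z)) holomorphic_on UNIV"
proof -
  define a where "a n = (LINT t|lebesgue. h t * of_real t ^ n / fact n)" for n
  have tm: "(\<lambda>t. complex_of_real t) \<in> borel_measurable lebesgue"
    by (intro borel_measurable_lebesgueI borel_measurable_continuous_onI continuous_intros)
  have int_n: "integrable lebesgue (\<lambda>t. h t * of_real t ^ n / fact n)" for n
  proof (rule Bochner_Integration.integrable_bound[OF int[of "real n"]])
    show "(\<lambda>t. h t * of_real t ^ n / fact n) \<in> borel_measurable lebesgue" using h tm by measurable
    have "norm (h t * of_real t ^ n / fact n) \<le> norm (norm (h t) * exp (real n * \<bar>t\<bar>))" for t
    proof -
      have "\<bar>t\<bar> ^ n / fact n \<le> \<bar>t\<bar> ^ n / 1" by (intro divide_left_mono) (auto simp: fact_ge_1)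
      then have "\<bar>t\<bar> ^ n / fact n \<le> exp (real n * \<bar>t\<bar>)" using power_le_exp_abs[of t n] by simp
      then have "norm (h t) * (\<bar>t\<bar> ^ n / fact n) \<le> norm (h t) * exp (real n * \<bar>t\<bar>)" by (intro mult_left_mono) auto
      then show ?thesis by (simp add: norm_mult norm_divide norm_power abs_mult)
    qed
    then show "AE t in lebesgue. norm (h t * of_real t ^ n / fact n) \<le> norm (norm (h t) * exp (real n * \<bar>t\<bar>))" by simp
  qed
  have sums: "(\<lambda>n. a n * z ^ n) sums (LINT t|lebesgue. h t * exp (of_real t * z))" for z
  proof -
    have "(\<lambda>N. LINT t|lebesgue. h t * (\<Sum>n<N. (of_real t * z) ^ n / fact n)) \<longlonglongrightarrow> (LINT t|lebesgue. h t * exp (of_real t * z))"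
    proof (rule integral_dominated_convergence)
      show "(\<lambda>t. h t * exp (of_real t * z)) \<in> borel_measurable lebesgue"
        "(\<lambda>t. h t * (\<Sum>n<N. (of_real t * z) ^ n / fact n)) \<in> borel_measurable lebesgue" for N
        by (intro borel_measurable_times[OF h] borel_measurable_lebesgueI borel_measurable_continuous_onI continuous_intros; simp)+
      show "integrable lebesgue (\<lambda>t. norm (h t) * exp (norm z * \<bar>t\<bar>))" by (rule int)
      show "AE t in lebesgue. (\<lambda>N. h t * (\<Sum>n<N. (of_real t * z) ^ n / fact n)) \<longlonglongrightarrow> h t * exp (of_real t * z)"
        by (intro AE_I2 tendsto_intros exp_partial_sums)
      show "AE t in lebesgue. norm (h t * (\<Sum>n<N. (of_real t * z) ^ n / fact n)) \<le> norm (h t) * exp (norm z * \<bar>t\<bar>)" for N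
      proof (rule AE_I2)
        fix t :: real
        show "norm (h t * (\<Sum>n<N. (of_real t * z) ^ n / fact n)) \<le> norm (h t) * exp (norm z * \<bar>t\<bar>)"
          using norm_exp_partial_sum_le[of "of_real t * z" N]
          by (simp add: norm_mult mult_left_mono mult.commute)
      qed
    qed
    moreover have "(LINT t|lebesgue. h t * (\<Sum>n<N. (of_real t * z) ^ n / fact n)) = (\<Sum>n<N. a n * z ^ n)" for N
    proof -
      have "h t * (\<Sum>n<N. (of_real t * z) ^ n / fact n) = (\<Sum>n<N. (h t * of_real t ^ n / fact n) * z ^ n)" for t
        by (simp add: sum_distrib_left power_mult_distrib mult_ac)
      then have "(LINT t|lebesgue. h t * (\<Sum>n<N. (of_real t * z) ^ n / fact n))
          = (LINT t|lebesgue. (\<Sum>n<N. (h t * of_real t ^ n / fact n) * z ^ n))" by (simp only:)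
      also have "\<dots> = (\<Sum>n<N. (LINT t|lebesgue. (h t * of_real t ^ n / fact n) * z ^ n))"
        by (rule Bochner_Integration.integral_sum) (intro integrable_mult_left int_n)
      also have "\<dots> = (\<Sum>n<N. a n * z ^ n)" by (simp only: integral_mult_left_zero a_def)
      finally show ?thesis .
    qed
    ultimately show ?thesis by (simp add: sums_def)
  qed
  have "(\<lambda>z. LINT t|lebesgue. h t * exp (of_real t * z)) holomorphic_on ball 0 r" for r
    by (rule power_series_holomorphic[where a = a]) (simp add: sums)
  then have "(\<lambda>z. LINT t|lebesgue. h t * exp (of_real t * z)) field_differentiable (at z)" for z
    using holomorphic_on_imp_differentiable_at[of _ "ball 0 (norm z + 1)" z] by simp
  then show ?thesis by (auto simp: holomorphic_on_def intro: field_differentiable_at_within)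
qed

section \<open>The Bargmann transform and Hermite functions\<close>

lemma bargmann_kernel_eq:
  fixes z :: complex
  shows "exp (2 * of_real pi * of_real t * z - of_real (pi * t\<^sup>2) - of_real pi / 2 * z\<^sup>2) =
      exp (- (of_real pi / 2 * z\<^sup>2)) * (of_real (gauss t) * exp (of_real t * (2 * of_real pi * z)))"
  unfolding gauss_def exp_of_real[symmetric] exp_add[symmetric]
  by (rule arg_cong[of _ _ exp]) (simp add: algebra_simps)

text \<open>A zero-free entire factor times the Laplace transform of \<open>f\<close> times the
  Gaussian; linearity, holomorphy and injectivity are all read off this form.\<close>

lemma bargmann_eq_laplace:
  "bargmann f z = of_real (2 powr (1/4)) * exp (- (of_real pi / 2 * z\<^sup>2)) *
     (LINT t|lebesgue. f t * of_real (gauss t) * exp (of_real t * (2 * of_real pi * z)))"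
proof -
  have "f t * (exp (- (of_real pi / 2 * z\<^sup>2)) * (of_real (gauss t) * exp (of_real t * (2 * of_real pi * z)))) =
      exp (- (of_real pi / 2 * z\<^sup>2)) * (f t * of_real (gauss t) * exp (of_real t * (2 * of_real pi * z)))" for t
    by simp
  then show ?thesis unfolding bargmann_def bargmann_kernel_eq by (simp only: integral_mult_right_zero mult.assoc)
qed

lemma exp_gauss_L2: "(\<lambda>t. exp (of_real t * w) * of_real (gauss t)) \<in> L2"
proof (rule L2_poly_gauss_bound[where C = 1 and b = "norm w"])
  show "(\<lambda>t. exp (complex_of_real t * w)) \<in> borel_measurable borel"
    by (intro borel_measurable_continuous_onI continuous_intros)
  show "norm (exp (complex_of_real t * w)) \<le> 1 * exp (norm w * \<bar>t\<bar>)" for t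
    using norm_exp[of "complex_of_real t * w"] by (simp add: norm_mult mult.commute)
qed

lemma bargmann_integrable:
  assumes "f \<in> L2"
  shows "integrable lebesgue (\<lambda>t. f t * of_real (gauss t) * exp (of_real t * w))"
  using L2_mult_integrable[OF assms exp_gauss_L2[of w]] by (simp add: mult_ac)

lemma bargmann_cmult: "bargmann (\<lambda>t. c * f t) z = c * bargmann f z"
  unfolding bargmann_def by (simp add: mult.assoc mult.left_commute)

lemma bargmann_add: "f \<in> L2 \<Longrightarrow> g \<in> L2 \<Longrightarrow> bargmann (\<lambda>t. f t + g t) z = bargmann f z + bargmann g z"
  unfolding bargmann_eq_laplace by (simp add: distrib_right bargmann_integrable) (simp add: distrib_left)

lemma bargmann_diff: "f \<in> L2 \<Longrightarrow> g \<in> L2 \<Longrightarrow> bargmann (\<lambda>t. f t - g t) z = bargmann f z - bargmann g z"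
  unfolding bargmann_eq_laplace by (simp add: left_diff_distrib bargmann_integrable) (simp add: right_diff_distrib)

lemma bargmann_sum:
  assumes "\<And>i. i \<in> I \<Longrightarrow> f i \<in> L2"
  shows "bargmann (\<lambda>t. \<Sum>i\<in>I. c i * f i t) z = (\<Sum>i\<in>I. c i * bargmann (f i) z)"
  using assms
proof (induction I rule: infinite_finite_induct)
  case (insert i I)
  then have "bargmann (\<lambda>t. c i * f i t + (\<Sum>i\<in>I. c i * f i t)) z =
      bargmann (\<lambda>t. c i * f i t) z + bargmann (\<lambda>t. \<Sum>i\<in>I. c i * f i t) z"
    by (intro bargmann_add L2_cmult L2_sum) auto
  then show ?case using insert by (simp add: bargmann_cmult)
qed (simp_all add: bargmann_def)

lemma bargmann_cong_AE:
  assumes "AE t in lebesgue. f t = g t" "f \<in> L2" "g \<in> L2"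
  shows "bargmann f z = bargmann g z"
proof -
  have "(LINT t|lebesgue. f t * of_real (gauss t) * exp (of_real t * (2 * of_real pi * z))) =
      (LINT t|lebesgue. g t * of_real (gauss t) * exp (of_real t * (2 * of_real pi * z)))"
    using assms by (intro integral_cong_AE borel_measurable_integrable bargmann_integrable) auto
  then show ?thesis by (simp add: bargmann_eq_laplace)
qed

lemma bargmann_entire:
  assumes f: "f \<in> L2"
  shows "bargmann f holomorphic_on UNIV"
proof -
  have "(\<lambda>z. LINT t|lebesgue. f t * of_real (gauss t) * exp (of_real t * z)) holomorphic_on UNIV"
  proof (rule laplace_transform_entire)
    fix b :: real
    have "(\<lambda>t. of_real (exp (b * \<bar>t\<bar>)) * of_real (gauss t)) \<in> L2"
      by (rule L2_poly_gauss_bound[where C = 1 and b = b])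
         (auto intro!: borel_measurable_continuous_onI continuous_intros)
    from integrable_norm[OF L2_mult_integrable[OF f this]]
    show "integrable lebesgue (\<lambda>t. norm (f t * of_real (gauss t)) * exp (b * \<bar>t\<bar>))"
      by (simp add: norm_mult mult_ac)
    show "(\<lambda>t. f t * of_real (gauss t)) \<in> borel_measurable lebesgue"
      using bargmann_integrable[OF f, of 0] by (auto dest: borel_measurable_integrable)
  qed
  then have "((\<lambda>z. LINT t|lebesgue. f t * of_real (gauss t) * exp (of_real t * z)) \<circ> (\<lambda>z. 2 * of_real pi * z)) holomorphic_on UNIV"
    by (intro holomorphic_on_compose_gen[where t = UNIV] holomorphic_intros) auto
  then show ?thesis unfolding bargmann_eq_laplace[abs_def] by (intro holomorphic_intros) (auto simp: o_def)
qed

text \<open>On the imaginary axis the transform is, up to a nonzero factor, the Fourier transform of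
  \<open>f\<close> times the Gaussian.\<close>

lemma bargmann_injective:
  assumes f: "f \<in> L2" and zero: "\<And>z. bargmann f z = 0"
  shows "AE t in lebesgue. f t = 0"
proof (rule fourier_injective[OF f])
  fix \<omega> :: real
  have "exp (of_real t * (2 * of_real pi * (\<i> * of_real (\<omega> / (2 * pi))))) = cis (\<omega> * t)" for t
    by (simp add: cis_conv_exp mult_ac)
  then show "(LINT t|lebesgue. f t * of_real (gauss t) * cis (\<omega> * t)) = 0"
    using zero[of "\<i> * of_real (\<omega> / (2 * pi))"] by (simp add: bargmann_eq_laplace)
qed

lemma integral_exp_quadratic:
  assumes "c > 0"
  shows "(LINT t|lebesgue. exp (b * t - c * t\<^sup>2)) = exp (b\<^sup>2 / (4 * c)) * sqrt (pi / c)"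
  using assms by (subst integral_completion) (simp_all add: exp_quadratic_eq_normal_density)

lemma norm_gabor: "norm (gabor f p) = norm (bargmann f (conj_point p)) * exp (- (pi / 2 * (norm (conj_point p))\<^sup>2))"
proof (cases p)
  case (Pair x \<omega>)
  define z where "z = conj_point p"
  have z: "z = Complex x (- \<omega>)" by (simp add: z_def conj_point_def Pair)
  \<comment> \<open>A unimodular phase times the Fock weight, obtained by expanding the square in
    the Gabor kernel.\<close>
  define c where "c = exp (\<i> * of_real (- (pi * x * \<omega>))) * of_real (exp (- (pi / 2 * (norm z)\<^sup>2)))"
  have "f t * exp (- of_real (pi * (t - x)\<^sup>2) - 2 * of_real pi * \<i> * of_real t * of_real \<omega>) =
      c * (f t * exp (2 * of_real pi * of_real t * z - of_real (pi * t\<^sup>2) - of_real pi / 2 * z\<^sup>2))" for t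
  proof -
    have "- of_real (pi * (t - x)\<^sup>2) - 2 * of_real pi * \<i> * of_real t * of_real \<omega> =
      \<i> * of_real (- (pi * x * \<omega>)) + complex_of_real (- (pi / 2 * (norm z)\<^sup>2)) +
        (2 * of_real pi * of_real t * z - of_real (pi * t\<^sup>2) - of_real pi / 2 * z\<^sup>2)"
      unfolding cmod_power2 z by (simp add: complex_eq_iff power2_eq_square field_simps)
    then have "exp (- of_real (pi * (t - x)\<^sup>2) - 2 * of_real pi * \<i> * of_real t * of_real \<omega>) =
      c * exp (2 * of_real pi * of_real t * z - of_real (pi * t\<^sup>2) - of_real pi / 2 * z\<^sup>2)"
      by (simp only: exp_add exp_of_real c_def)
    then show ?thesis by simp
  qed
  then have "(LINT t|lebesgue. f t * exp (- of_real (pi * (t - x)\<^sup>2) - 2 * of_real pi * \<i> * of_real t * of_real \<omega>)) =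
      c * (LINT t|lebesgue. f t * exp (2 * of_real pi * of_real t * z - of_real (pi * t\<^sup>2) - of_real pi / 2 * z\<^sup>2))"
    by (simp only: integral_mult_right_zero)
  then have "gabor f p = c * bargmann f z" unfolding gabor_def Pair bargmann_def prod.case by (simp only: mult.left_commute)
  moreover have "norm c = exp (- (pi / 2 * (norm z)\<^sup>2))" by (simp add: c_def norm_mult)
  ultimately show ?thesis by (simp add: norm_mult z_def mult.commute)
qed

text \<open>The kernel has modulus \<open>exp (pi / 2 * (norm z)\<^sup>2)\<close> times a Gaussian
  in \<open>t\<close> centred at \<open>Re z\<close>, whose square integral does not depend on
  \<open>z\<close>.\<close>

lemma bargmann_growth:
  assumes f: "f \<in> L2"
  shows "\<exists>A. \<forall>z. norm (bargmann f z) \<le> A * exp (pi / 2 * (norm z)\<^sup>2)"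
proof -
  define I where "I = (LINT t|lebesgue. (norm (f t))\<^sup>2)"
  have "norm (bargmann f z) \<le> (2 powr (1/4) * (I + sqrt (1 / 2))) * exp (pi / 2 * (norm z)\<^sup>2)" for z
  proof -
    define x where "x = Re z"
    define e where "e t = exp (4 * pi * x * t - 2 * pi * t\<^sup>2)" for t
    have ie: "integrable lebesgue e" unfolding e_def by (intro integrable_exp_quadratic) simp
    have Le: "(LINT t|lebesgue. exp (- (2 * pi * x\<^sup>2)) * e t) = sqrt (1 / 2)"
    proof -
      have "(LINT t|lebesgue. exp (- (2 * pi * x\<^sup>2)) * e t) = exp (- (2 * pi * x\<^sup>2)) * (LINT t|lebesgue. e t)" by simp
      also have "(LINT t|lebesgue. e t) = exp ((4 * pi * x)\<^sup>2 / (4 * (2 * pi))) * sqrt (pi / (2 * pi))"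
        unfolding e_def by (rule integral_exp_quadratic) simp
      also have "(4 * pi * x)\<^sup>2 / (4 * (2 * pi)) = 2 * pi * x\<^sup>2" by (simp add: power2_eq_square field_simps)
      also have "exp (- (2 * pi * x\<^sup>2)) * (exp (2 * pi * x\<^sup>2) * sqrt (pi / (2 * pi))) = sqrt (1 / 2)"
        unfolding mult.assoc[symmetric] exp_add[symmetric] by simp
      finally show ?thesis .
    qed
    define h where "h t = f t * exp (2 * of_real pi * of_real t * z - of_real (pi * t\<^sup>2) - of_real pi / 2 * z\<^sup>2)" for t
    have nh: "norm (h t) = exp (pi / 2 * (norm z)\<^sup>2) * (norm (f t) * exp (- (pi * (t - x)\<^sup>2)))" for t
    proof -
      have r1: "2 * pi * t * x - pi * t\<^sup>2 - pi / 2 * (x\<^sup>2 - (Im z)\<^sup>2) = pi / 2 * (norm z)\<^sup>2 + - (pi * (t - x)\<^sup>2)"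
        unfolding cmod_power2 x_def by (simp add: power2_eq_square field_simps)
      have r2: "Re (2 * of_real pi * of_real t * z - of_real (pi * t\<^sup>2) - of_real pi / 2 * z\<^sup>2) =
          2 * pi * t * x - pi * t\<^sup>2 - pi / 2 * (x\<^sup>2 - (Im z)\<^sup>2)"
        by (simp add: x_def power2_eq_square)
      show ?thesis unfolding h_def norm_mult norm_exp_eq_Re r2 r1 exp_add by simp
    qed
    have "norm (LINT t|lebesgue. h t) \<le> (LINT t|lebesgue. norm (h t))" by (rule integral_norm_bound)
    also have "\<dots> \<le> (LINT t|lebesgue. exp (pi / 2 * (norm z)\<^sup>2) * ((norm (f t))\<^sup>2 + exp (- (2 * pi * x\<^sup>2)) * e t))"
    proof (rule integral_mono)
      have "h = (\<lambda>t. exp (- (of_real pi / 2 * z\<^sup>2)) * (f t * of_real (gauss t) * exp (of_real t * (2 * of_real pi * z))))"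
        unfolding h_def bargmann_kernel_eq by (simp add: mult_ac)
      then have "integrable lebesgue h" using bargmann_integrable[OF f] by simp
      then show "integrable lebesgue (\<lambda>t. norm (h t))" by (rule integrable_norm)
      show "integrable lebesgue (\<lambda>t. exp (pi / 2 * (norm z)\<^sup>2) * ((norm (f t))\<^sup>2 + exp (- (2 * pi * x\<^sup>2)) * e t))"
        using ie L2_integrable[OF f] by simp
      fix t
      have "(exp (- (pi * (t - x)\<^sup>2)))\<^sup>2 = exp (- (2 * pi * x\<^sup>2)) * e t"
        unfolding e_def exp_double[symmetric] exp_add[symmetric] by (simp add: power2_eq_square algebra_simps)
      moreover have "norm (f t) * exp (- (pi * (t - x)\<^sup>2)) \<le> (norm (f t))\<^sup>2 + (exp (- (pi * (t - x)\<^sup>2)))\<^sup>2"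
      proof -
        have "2 * (norm (f t) * exp (- (pi * (t - x)\<^sup>2))) \<le> (norm (f t))\<^sup>2 + (exp (- (pi * (t - x)\<^sup>2)))\<^sup>2"
          using zero_le_power2[of "norm (f t) - exp (- (pi * (t - x)\<^sup>2))"] by (simp add: power2_diff)
        moreover have "norm (f t) * exp (- (pi * (t - x)\<^sup>2)) \<ge> 0" by simp
        ultimately show ?thesis by linarith
      qed
      ultimately show "norm (h t) \<le> exp (pi / 2 * (norm z)\<^sup>2) * ((norm (f t))\<^sup>2 + exp (- (2 * pi * x\<^sup>2)) * e t)"
        unfolding nh by (intro mult_left_mono) auto
    qed
    also have "\<dots> = exp (pi / 2 * (norm z)\<^sup>2) * (I + sqrt (1 / 2))"
      using ie L2_integrable[OF f] Le by (simp add: I_def)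
    finally have "norm (LINT t|lebesgue. h t) \<le> exp (pi / 2 * (norm z)\<^sup>2) * (I + sqrt (1 / 2))" .
    then have "2 powr (1/4) * norm (LINT t|lebesgue. h t) \<le> 2 powr (1/4) * (exp (pi / 2 * (norm z)\<^sup>2) * (I + sqrt (1 / 2)))"
      by (intro mult_left_mono) auto
    moreover have "norm (bargmann f z) = 2 powr (1/4) * norm (LINT t|lebesgue. h t)"
      unfolding bargmann_def h_def norm_mult by simp
    ultimately show ?thesis by (simp only: mult_ac)
  qed
  then show ?thesis by blast
qed

section \<open>Images of polynomials times the Gaussian, and the Hermite functions\<close>

definition gauss_moment :: "nat \<Rightarrow> real" where
  "gauss_moment j = (LINT s|lebesgue. s ^ j * exp (- (2 * pi * s\<^sup>2)))"

lemma gauss_moment_0_pos: "gauss_moment 0 > 0"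
  using integral_exp_quadratic[of "2 * pi" 0] by (simp add: gauss_moment_def)

lemma integrable_gauss_moment: "integrable lebesgue (\<lambda>s. s ^ j * exp (- (2 * pi * s\<^sup>2)))"
proof (rule Bochner_Integration.integrable_bound)
  show "integrable lebesgue (\<lambda>s::real. exp (real j * \<bar>s\<bar> - 2 * pi * s\<^sup>2))"
    by (rule integrable_exp_abs_quadratic) simp
  show "(\<lambda>s::real. s ^ j * exp (- (2 * pi * s\<^sup>2))) \<in> borel_measurable lebesgue"
    by (intro borel_measurable_lebesgueI) measurable
  have "norm (s ^ j * exp (- (2 * pi * s\<^sup>2))) \<le> norm (exp (real j * \<bar>s\<bar> - 2 * pi * s\<^sup>2))" for s :: real
    using power_le_exp_abs[of s j]
    by (simp add: abs_mult power_abs exp_diff exp_minus divide_inverse mult_right_mono)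
  then show "AE s in lebesgue. norm (s ^ j * exp (- (2 * pi * s\<^sup>2))) \<le> norm (exp (real j * \<bar>s\<bar> - 2 * pi * s\<^sup>2))"
    by simp
qed

text \<open>A triangular matrix: the binomial coefficient vanishes for \<open>k > n\<close>, and the
  diagonal is nonzero because \<open>gauss_moment 0\<close> is positive.\<close>

definition bargmann_coeff :: "nat \<Rightarrow> nat \<Rightarrow> real" where
  "bargmann_coeff n k = 2 powr (1/4) * (real (n choose k) * (1 / 2) ^ k * gauss_moment (n - k))"

text \<open>For real argument the Gaussian and the kernel combine to a Gaussian centred at
  \<open>x / 2\<close>. A real translation and the binomial theorem then give the moments.\<close>

lemma bargmann_monomial_real:
  "bargmann (poly_gauss (monom 1 n)) (of_real x) = of_real (\<Sum>k\<le>n. bargmann_coeff n k * x ^ k)"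
proof -
  have "poly_gauss (monom 1 n) t * exp (2 * of_real pi * of_real t * of_real x - of_real (pi * t\<^sup>2) - of_real pi / 2 * (of_real x)\<^sup>2)
    = complex_of_real (t ^ n * exp (- (2 * pi * (t - x / 2)\<^sup>2)))" for t
  proof -
    have "gauss t * exp (2 * pi * t * x - pi * t\<^sup>2 - pi / 2 * x\<^sup>2) = exp (- (2 * pi * (t - x / 2)\<^sup>2))"
      unfolding gauss_def exp_add[symmetric] by (simp add: power2_eq_square field_simps)
    then have "complex_of_real (t ^ n * (gauss t * exp (2 * pi * t * x - pi * t\<^sup>2 - pi / 2 * x\<^sup>2)))
       = complex_of_real (t ^ n * exp (- (2 * pi * (t - x / 2)\<^sup>2)))" by simp
    then show ?thesis by (simp add: poly_gauss_def poly_monom flip: exp_of_real)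
  qed
  then have "bargmann (poly_gauss (monom 1 n)) (of_real x) =
      of_real (2 powr (1/4) * (LINT t|lebesgue. t ^ n * exp (- (2 * pi * (t - x / 2)\<^sup>2))))"
    unfolding bargmann_def by (simp flip: integral_complex_of_real)
  also have "(LINT t|lebesgue. t ^ n * exp (- (2 * pi * (t - x / 2)\<^sup>2))) =
      (LINT s|lebesgue. (x / 2 + s) ^ n * exp (- (2 * pi * s\<^sup>2)))"
    using lebesgue_integral_real_affine[of 1 "\<lambda>t. t ^ n * exp (- (2 * pi * (t - x / 2)\<^sup>2))" "x / 2"] by simp
  also have "\<dots> = (LINT s|lebesgue. (\<Sum>k\<le>n. (real (n choose k) * (x / 2) ^ k) * (s ^ (n - k) * exp (- (2 * pi * s\<^sup>2)))))"
    unfolding binomial_ring sum_distrib_right by (simp add: mult_ac)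
  also have "\<dots> = (\<Sum>k\<le>n. (real (n choose k) * (x / 2) ^ k) * gauss_moment (n - k))"
    unfolding gauss_moment_def
    by (subst Bochner_Integration.integral_sum) (auto intro!: integrable_mult_right integrable_gauss_moment)
  finally show ?thesis
    by (simp add: bargmann_coeff_def sum_distrib_left power_divide mult_ac)
qed

lemma bargmann_monomial:
  "bargmann (poly_gauss (monom 1 n)) z = (\<Sum>k\<le>n. of_real (bargmann_coeff n k) * z ^ k)"
proof -
  have "bargmann (poly_gauss (monom 1 n)) z - (\<Sum>k\<le>n. of_real (bargmann_coeff n k) * z ^ k) = 0"
  proof (rule analytic_continuation[where w = z and
        f = "\<lambda>z. bargmann (poly_gauss (monom 1 n)) z - (\<Sum>k\<le>n. of_real (bargmann_coeff n k) * z ^ k)" and S = UNIV and U = "\<real>" and \<xi> = 0])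
    show "(\<lambda>z. bargmann (poly_gauss (monom 1 n)) z - (\<Sum>k\<le>n. of_real (bargmann_coeff n k) * z ^ k)) holomorphic_on UNIV"
      by (intro holomorphic_intros bargmann_entire poly_gauss_L2)
    show "(0::complex) islimpt \<real>"
      unfolding islimpt_approachable
    proof (intro allI impI)
      fix e :: real assume "e > 0"
      then show "\<exists>x'\<in>\<real>. x' \<noteq> 0 \<and> dist x' (0::complex) < e"
        by (intro bexI[of _ "of_real (e / 2)"]) auto
    qed
  qed (auto simp: bargmann_monomial_real elim!: Reals_cases)
  then show ?thesis by simp
qed

text \<open>Inversion of the triangular system: the lower powers have preimages by induction and are
  subtracted, leaving a nonzero multiple of \<open>z ^ n\<close>.\<close>

lemma bargmann_preimage_power: "\<exists>p. \<forall>z. bargmann (poly_gauss p) z = z ^ n"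
proof (induction n rule: less_induct)
  case (less n)
  then have "\<forall>k. \<exists>p. k < n \<longrightarrow> (\<forall>z. bargmann (poly_gauss p) z = z ^ k)" by blast
  from choice[OF this] obtain q where q: "\<And>k z. k < n \<Longrightarrow> bargmann (poly_gauss (q k)) z = z ^ k" by blast
  define a where "a k = complex_of_real (bargmann_coeff n k)" for k
  have an: "a n \<noteq> 0" using gauss_moment_0_pos by (simp add: a_def bargmann_coeff_def)
  define p where "p = smult (1 / a n) (monom 1 n - (\<Sum>k<n. smult (a k) (q k)))"
  have "poly_gauss p = (\<lambda>t. (1 / a n) * (poly_gauss (monom 1 n) t - (\<Sum>k<n. a k * poly_gauss (q k) t)))"
  proof (rule ext)
    fix t
    have "poly (\<Sum>k<n. smult (a k) (q k)) (of_real t) * of_real (gauss t) = (\<Sum>k<n. a k * poly_gauss (q k) t)"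
      by (simp add: poly_sum sum_distrib_right poly_gauss_def mult.assoc)
    then show "poly_gauss p t = (1 / a n) * (poly_gauss (monom 1 n) t - (\<Sum>k<n. a k * poly_gauss (q k) t))"
      by (simp add: p_def poly_gauss_def left_diff_distrib)
  qed
  then have "bargmann (poly_gauss p) z = (1 / a n) * (bargmann (poly_gauss (monom 1 n)) z - (\<Sum>k<n. a k * bargmann (poly_gauss (q k)) z))" for z
    by (simp only: bargmann_cmult bargmann_diff bargmann_sum poly_gauss_L2 L2_sum L2_cmult)
  moreover have "bargmann (poly_gauss (monom 1 n)) z - (\<Sum>k<n. a k * bargmann (poly_gauss (q k)) z) = a n * z ^ n" for z
    by (simp add: bargmann_monomial q a_def flip: lessThan_Suc_atMost)
  ultimately have "bargmann (poly_gauss p) z = z ^ n" for z using an by simp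
  then show ?case by blast
qed

text \<open>\<open>inv_into\<close> returns a true preimage once some preimage exists; a scaled
  polynomial times the Gaussian is one.\<close>

lemma hermite_function: "hermite_function n \<in> L2" "bargmann (hermite_function n) = fock_monomial n"
proof -
  obtain p where p: "\<And>z. bargmann (poly_gauss p) z = z ^ n" using bargmann_preimage_power by blast
  define c where "c = complex_of_real (sqrt (pi ^ n / fact n))"
  have "bargmann (\<lambda>t. c * poly_gauss p t) = fock_monomial n"
    by (rule ext) (simp add: bargmann_cmult p fock_monomial_def c_def)
  moreover have "(\<lambda>t. c * poly_gauss p t) \<in> L2" by (intro L2_cmult poly_gauss_L2)
  ultimately have "fock_monomial n \<in> bargmann ` L2" by (metis imageI)
  then show "hermite_function n \<in> L2" "bargmann (hermite_function n) = fock_monomial n"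
    unfolding hermite_function_def by (rule inv_into_into, rule f_inv_into_f)
qed

lemma bargmann_poly_gauss:
  "bargmann (poly_gauss p) z = (\<Sum>j\<le>degree p. (\<Sum>k\<le>degree p. coeff p k * of_real (bargmann_coeff k j)) * z ^ j)"
proof -
  define N where "N = degree p"
  have "poly_gauss p = (\<lambda>t. \<Sum>k\<le>N. coeff p k * poly_gauss (monom 1 k) t)"
    unfolding poly_gauss_def N_def poly_altdef[of p] sum_distrib_right by (simp add: poly_monom mult.assoc)
  then have "bargmann (poly_gauss p) z = (\<Sum>k\<le>N. coeff p k * bargmann (poly_gauss (monom 1 k)) z)"
    by (simp only: bargmann_sum poly_gauss_L2)
  also have "\<dots> = (\<Sum>k\<le>N. coeff p k * (\<Sum>j\<le>N. of_real (bargmann_coeff k j) * z ^ j))"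
  proof (intro sum.cong refl arg_cong2[where f = times])
    fix k assume "k \<in> {..N}"
    then show "bargmann (poly_gauss (monom 1 k)) z = (\<Sum>j\<le>N. of_real (bargmann_coeff k j) * z ^ j)"
      unfolding bargmann_monomial
      by (intro sum.mono_neutral_left) (auto simp: bargmann_coeff_def binomial_eq_0)
  qed
  also have "\<dots> = (\<Sum>j\<le>N. (\<Sum>k\<le>N. coeff p k * of_real (bargmann_coeff k j)) * z ^ j)"
    unfolding sum_distrib_left sum_distrib_right by (subst sum.swap) (simp add: mult_ac)
  finally show ?thesis by (simp add: N_def)
qed

text \<open>Both sides have the same Bargmann transform. Equality is only almost everywhere, as
  \<open>hermite_function\<close> picks an arbitrary representative.\<close>

lemma poly_gauss_hermite_expansion:
  "\<exists>N c. AE t in lebesgue. poly_gauss p t = (\<Sum>j\<le>N. c j * hermite_function j t)"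
proof -
  define N where "N = degree p"
  define d where "d j = (\<Sum>k\<le>N. coeff p k * of_real (bargmann_coeff k j))" for j
  define c where "c j = d j / of_real (sqrt (pi ^ j / fact j))" for j
  define u where "u t = (\<Sum>j\<le>N. c j * hermite_function j t)" for t
  have uL: "u \<in> L2" unfolding u_def by (intro L2_sum L2_cmult hermite_function)
  have "bargmann u z = bargmann (poly_gauss p) z" for z
  proof -
    have "bargmann u z = (\<Sum>j\<le>N. c j * fock_monomial j z)"
      unfolding u_def by (simp only: bargmann_sum hermite_function)
    also have "\<dots> = (\<Sum>j\<le>N. d j * z ^ j)"
      by (intro sum.cong) (simp_all add: c_def fock_monomial_def)
    finally show ?thesis by (simp add: bargmann_poly_gauss d_def N_def)
  qed
  then have "AE t in lebesgue. poly_gauss p t - u t = 0"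
    by (intro bargmann_injective L2_diff poly_gauss_L2 uL) (simp add: bargmann_diff poly_gauss_L2 uL)
  then have "AE t in lebesgue. poly_gauss p t = u t" by simp
  then show ?thesis unfolding u_def by blast
qed

lemma hermite_span_dense:
  assumes w: "w \<in> L2" and \<epsilon>: "\<epsilon> > 0"
  obtains N c where "L2_norm (\<lambda>t. w t - (\<Sum>j\<le>N. c j * hermite_function j t)) < \<epsilon>"
proof -
  obtain p where p: "(LINT t|lebesgue. (norm (w t - poly_gauss p t))\<^sup>2) < \<epsilon>\<^sup>2"
  proof -
    have "\<epsilon>\<^sup>2 > 0" using \<epsilon> by simp
    then show ?thesis using L2_limit_poly_gauss[OF w] that unfolding L2_limit_def by blast
  qed
  obtain N c where ae: "AE t in lebesgue. poly_gauss p t = (\<Sum>j\<le>N. c j * hermite_function j t)"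
    using poly_gauss_hermite_expansion by blast
  define u where "u t = (\<Sum>j\<le>N. c j * hermite_function j t)" for t
  have uL: "u \<in> L2" unfolding u_def by (intro L2_sum L2_cmult hermite_function)
  have "(LINT t|lebesgue. (norm (w t - u t))\<^sup>2) = (LINT t|lebesgue. (norm (w t - poly_gauss p t))\<^sup>2)"
    using ae[folded u_def] w uL
    by (intro integral_cong_AE borel_measurable_integrable L2_integrable L2_diff poly_gauss_L2) auto
  then have "L2_norm (\<lambda>t. w t - u t) < \<epsilon>"
    using p \<epsilon> unfolding L2_norm_def by (simp add: real_less_lsqrt)
  then show ?thesis using that unfolding u_def by blast
qed

section \<open>Phase retrieval\<close>

theorem bargmann_phase_retrieval:
  fixes \<Lambda> :: "(real \<times> real) set"
  assumes ud: "uniform_discrete \<Lambda>" and dens: "lower_beurling_density \<Lambda> > 1"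
    and f: "f \<in> L2" and I: "finite I"
    and eq: "\<And>w. w \<in> conj_point ` \<Lambda> \<Longrightarrow> norm (bargmann f w) = norm (\<Sum>n\<in>I. c n * fock_monomial n w)"
  shows "\<exists>\<sigma>. norm \<sigma> = 1 \<and> (\<forall>z. bargmann f z = \<sigma> * (\<Sum>n\<in>I. c n * fock_monomial n z))"
proof -
  define L where "L = conj_point ` \<Lambda>"
  obtain e where e: "e > 0" "\<And>x y. x \<in> \<Lambda> \<Longrightarrow> y \<in> \<Lambda> \<Longrightarrow> dist x y < e \<Longrightarrow> x = y"
    using ud unfolding uniform_discrete_def by blast
  have sep: "norm (a - b) \<ge> e" if ab: "a \<in> L" "b \<in> L" "a \<noteq> b" for a b
  proof -
    obtain p q where pq: "p \<in> \<Lambda>" "q \<in> \<Lambda>" "a = conj_point p" "b = conj_point q" using ab by (auto simp: L_def)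
    then show ?thesis using e(2)[of p q] ab(3) by (force simp: conj_point_dist)
  qed
  obtain s \<gamma> where s: "s > 0" "\<gamma> > 1" "\<And>z. \<gamma> * s\<^sup>2 \<le> real (card (L \<inter> square_around s z))"
    using density_gt_one_squares[OF dens] unfolding L_def by metis
  \<comment> \<open>Every square of side \<open>s\<close> has a positive count, hence contains a
    point of \<open>L\<close>.\<close>
  have dense: "\<exists>w\<in>L. norm (w - z) \<le> s" for z
  proof -
    have "0 < \<gamma> * s\<^sup>2" using s by simp
    then have "card (L \<inter> square_around s z) \<noteq> 0" using s(3)[of z] by linarith
    then show ?thesis using square_around_dist by (metis IntE card.empty ex_in_conv)
  qed
  \<comment> \<open>Inserting 0 keeps \<open>Max\<close> meaningful for empty \<open>I\<close>. Sums
    run over \<open>j < Suc n\<close> because Liouville's theorem returns all degrees up to the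
    growth exponent \<open>n\<close>.\<close>
  define n where "n = Suc (Max (insert 0 I))"
  have In: "j < n" if "j \<in> I" for j
    using I that by (simp add: n_def less_Suc_eq_le)
  define b where "b j = (if j \<in> I then c j * of_real (sqrt (pi ^ j / fact j)) else 0)" for j
  have P: "(\<Sum>k\<in>I. c k * fock_monomial k z) = (\<Sum>j<Suc n. b j * z ^ j)" for z
  proof -
    have "(\<Sum>k\<in>I. c k * fock_monomial k z) = (\<Sum>j\<in>I. b j * z ^ j)"
      by (intro sum.cong) (auto simp: b_def fock_monomial_def)
    also have "\<dots> = (\<Sum>j<Suc n. b j * z ^ j)"
      by (intro sum.mono_neutral_left) (use In in \<open>auto simp: b_def less_Suc_eq\<close>)
    finally show ?thesis .
  qed
  have Pbound: "norm (\<Sum>j<Suc n. b j * z ^ j) \<le> (\<Sum>j<Suc n. norm (b j)) * (1 + norm z) ^ n" for z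
    unfolding sum_distrib_right
  proof (rule sum_norm_le)
    fix j assume "j \<in> {..<Suc n}"
    then have "norm z ^ j \<le> (1 + norm z) ^ j" "(1 + norm z) ^ j \<le> (1 + norm z) ^ n"
      by (auto intro!: power_mono power_increasing)
    then show "norm (b j * z ^ j) \<le> norm (b j) * (1 + norm z) ^ n"
      by (simp add: norm_mult norm_power mult_left_mono)
  qed
  obtain A where A: "\<And>z. norm (bargmann f z) \<le> A * exp (pi / 2 * (norm z)\<^sup>2)" using bargmann_growth[OF f] by blast
  have "\<exists>C. \<forall>z. norm (bargmann f z) \<le> C * (1 + norm z) ^ n"
  proof (rule polynomial_growth_from_samples[OF bargmann_entire[OF f] A sep e(1) s])
    show "norm (bargmann f a) \<le> (\<Sum>j<Suc n. norm (b j)) * (1 + norm a) ^ n" if "a \<in> L" for a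
      using eq[of a] that Pbound[of a] by (simp only: L_def P)
  qed
  then obtain C where C: "\<And>z. norm (bargmann f z) \<le> C * (1 + norm z) ^ n" by blast
  have "norm (bargmann f 0) \<le> C" using C[of 0] by simp
  then have C0: "C \<ge> 0" by (rule order_trans[OF norm_ge_zero])
  define a where "a k = (deriv ^^ k) (bargmann f) 0 / fact k" for k
  have F: "bargmann f z = (\<Sum>j<Suc n. a j * z ^ j)" for z
    unfolding a_def lessThan_Suc_atMost
  proof (rule Liouville_polynomial[OF bargmann_entire[OF f], of 1 "C * 2 ^ n"])
    \<comment> \<open>Outside the unit disc \<open>1 + norm z \<le> 2 * norm z\<close>, which
      explains the constant \<open>C * 2 ^ n\<close>.\<close>
    fix z :: complex assume "1 \<le> norm z"
    then have "(1 + norm z) ^ n \<le> (2 * norm z) ^ n" by (intro power_mono) auto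
    then have "C * (1 + norm z) ^ n \<le> C * 2 ^ n * norm z ^ n"
      using C0 by (simp add: power_mult_distrib mult_left_mono mult.assoc)
    then show "norm (bargmann f z) \<le> C * 2 ^ n * norm z ^ n" using C[of z] by linarith
  qed
  obtain \<sigma> where "norm \<sigma> = 1" "\<forall>j<Suc n. a j = \<sigma> * b j"
    using poly_modulus_eq_on_relatively_dense[OF dense, where n = "Suc n" and a = a and b = b] eq unfolding L_def[symmetric] F P by blast
  then show ?thesis unfolding F P
    by (intro exI[of _ \<sigma>]) (simp add: sum_distrib_left mult.assoc del: sum.lessThan_Suc)
qed

lemma gabor_phase_retrieval:
  assumes ud: "uniform_discrete \<Lambda>" and dens: "lower_beurling_density \<Lambda> > 1"
    and f: "f \<in> L2" and g: "g \<in> L2" and I: "finite I"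
    and gh: "AE t in lebesgue. g t = (\<Sum>n\<in>I. c n * hermite_function n t)"
    and eq: "\<And>p. p \<in> \<Lambda> \<Longrightarrow> norm (gabor f p) = norm (gabor g p)"
  shows "phase_equiv f g"
proof -
  have "bargmann g z = bargmann (\<lambda>t. \<Sum>n\<in>I. c n * hermite_function n t) z" for z
    using gh g by (intro bargmann_cong_AE L2_sum L2_cmult hermite_function)
  then have Bg: "bargmann g z = (\<Sum>n\<in>I. c n * fock_monomial n z)" for z
    by (simp only: bargmann_sum hermite_function)
  obtain \<sigma> where \<sigma>: "norm \<sigma> = 1" "\<And>z. bargmann f z = \<sigma> * (\<Sum>n\<in>I. c n * fock_monomial n z)"
    using bargmann_phase_retrieval[OF ud dens f I, of c] eq by (force simp: norm_gabor Bg)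
  have "AE t in lebesgue. f t - \<sigma> * g t = 0"
    by (intro bargmann_injective L2_diff L2_cmult f g)
       (simp add: bargmann_diff bargmann_cmult L2_cmult f g \<sigma> Bg)
  then show ?thesis using \<sigma>(1) unfolding phase_equiv_def by (intro exI[of _ \<sigma>]) auto
qed

lemma phase_equiv_sym: "phase_equiv f g \<Longrightarrow> phase_equiv g f"
proof -
  assume "phase_equiv f g"
  then obtain \<sigma> where \<sigma>: "norm \<sigma> = 1" "AE t in lebesgue. f t = \<sigma> * g t" by (auto simp: phase_equiv_def)
  have "\<sigma> \<noteq> 0" using \<sigma>(1) by auto
  have "AE t in lebesgue. g t = inverse \<sigma> * f t"
    using \<sigma>(2) by eventually_elim (simp add: \<open>\<sigma> \<noteq> 0\<close>)
  then show ?thesis using \<sigma>(1) by (auto simp: phase_equiv_def norm_inverse intro!: exI[of _ "inverse \<sigma>"])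
qed

lemma phase_equiv_norm_gabor:
  assumes "phase_equiv f g" "f \<in> L2" "g \<in> L2"
  shows "norm (gabor f p) = norm (gabor g p)"
proof -
  obtain \<sigma> where \<sigma>: "norm \<sigma> = 1" "AE t in lebesgue. f t = \<sigma> * g t" using assms by (auto simp: phase_equiv_def)
  have "bargmann f z = \<sigma> * bargmann g z" for z
    using bargmann_cong_AE[OF \<sigma>(2) assms(2) L2_cmult[OF assms(3)]] by (simp add: bargmann_cmult)
  then show ?thesis using \<sigma>(1) by (simp add: norm_gabor norm_mult)
qed

theorem corollary3:
  fixes \<Lambda> :: "(real \<times> real) set"
  assumes "uniform_discrete \<Lambda>" and "lower_beurling_density \<Lambda> > 1"
  shows "(\<forall>f\<in>L2. \<forall>g\<in>L2. \<forall>(I :: nat set) (c :: nat \<Rightarrow> complex).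
            finite I \<longrightarrow> (AE t in lebesgue. g t = (\<Sum>n\<in>I. c n * hermite_function n t)) \<longrightarrow>
            (phase_equiv f g \<longleftrightarrow> (\<forall>p\<in>\<Lambda>. norm (gabor f p) = norm (gabor g p))))
       \<and> dense_in_L2 {u \<in> L2. \<forall>v\<in>L2.
            (\<forall>p\<in>\<Lambda>. norm (gabor u p) = norm (gabor v p)) \<longrightarrow> phase_equiv u v}"
proof (intro conjI ballI allI impI iffI)
  fix f g :: "real \<Rightarrow> complex" and p
  assume "f \<in> L2" "g \<in> L2" "phase_equiv f g"
  then show "norm (gabor f p) = norm (gabor g p)" by (intro phase_equiv_norm_gabor)
next
  fix f g :: "real \<Rightarrow> complex" and I c
  assume "f \<in> L2" "g \<in> L2" "finite I" "AE t in lebesgue. g t = (\<Sum>n\<in>I. c n * hermite_function n t)"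
    "\<forall>p\<in>\<Lambda>. norm (gabor f p) = norm (gabor g p)"
  then show "phase_equiv f g" using gabor_phase_retrieval[OF assms] by blast
next
  show "dense_in_L2 {u \<in> L2. \<forall>v\<in>L2. (\<forall>p\<in>\<Lambda>. norm (gabor u p) = norm (gabor v p)) \<longrightarrow> phase_equiv u v}"
    (is "dense_in_L2 ?S")
    unfolding dense_in_L2_def
  proof (intro conjI ballI allI impI)
    fix w \<epsilon> assume w: "w \<in> L2" "(\<epsilon>::real) > 0"
    obtain N c where Nc: "L2_norm (\<lambda>t. w t - (\<Sum>j\<le>N. c j * hermite_function j t)) < \<epsilon>"
      using hermite_span_dense[OF w] .
    define u where "u t = (\<Sum>j\<le>N. c j * hermite_function j t)" for t
    have uL: "u \<in> L2" unfolding u_def by (intro L2_sum L2_cmult hermite_function)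
    have "phase_equiv u v" if "v \<in> L2" "\<forall>p\<in>\<Lambda>. norm (gabor u p) = norm (gabor v p)" for v
    \<comment> \<open>Here the Hermite combination \<open>u\<close> plays the part of
      \<open>g\<close> and the competitor \<open>v\<close> that of \<open>f\<close>, hence the
      symmetry step.\<close>
    proof (rule phase_equiv_sym, rule gabor_phase_retrieval[OF assms that(1) uL])
      show "AE t in lebesgue. u t = (\<Sum>n\<in>{..N}. c n * hermite_function n t)" by (simp add: u_def)
    qed (use that in auto)
    then have "u \<in> ?S" using uL by blast
    have close: "L2_norm (\<lambda>t. w t - u t) < \<epsilon>" using Nc by (simp add: u_def)
    show "\<exists>u\<in>?S. L2_norm (\<lambda>t. w t - u t) < \<epsilon>"
      by (rule bexI[where x = u]) (fact close, fact \<open>u \<in> ?S\<close>)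
  qed auto
qed

end
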